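(* Let $m \geq 2$ be fixed. For every $n$, the graph $S_{m,n}$ has a set $T$ of $n+1$ vertices whose removal separates the remaining vertices into two sets $(S_{m,n})_a$ and $(S_{m,n})_b$ with no edge of $S_{m,n}$ between them, and, as $n\to\infty$, \[ |(S_{m,n})_a| \sim (1-C_m)|S_{m,n}|, \qquad |(S_{m,n})_b| \sim C_m|S_{m,n}|, \] where $|S_{m,n}|$ is the number of vertices of $S_{m,n}$ and $C_m = 1/(r_m^2(r_m-1)^2)$. These constants satisfy \[ 0.345\ldots \approx C_2 > C_3 > C_4 \geq \cdots \qquad\text{and}\qquad \lim_{m \rightarrow \infty} C_m = 1.5-\sqrt{2} \approx 0.0858\ldots. \]
   Context: For an integer $m\ge 0$, the strip of height $m$ is $\{(x,y)\in\mathbb{Z}^2 : x\ge 0,\ 0\le y\le m\}$. A monotone path of length $n$ in the strip of height $m$ is a lattice path that starts at $(0,0)$, takes $n$ steps, each equal to $N=(0,1)$, $S=(0,-1)$ or $E=(1,0)$, never retraces steps (no $N$ immediately followed by $S$ and no $S$ immediately by $N$), and stays within the strip. The graph $S_{m,n}$ (the transition kernel) has as vertices the monotone paths of length $n$ in the strip of height $m$, two paths being adjacent if one is obtained from the other by one of the following local moves (the result being again a monotone path in the strip): switching corners (two consecutive steps that go in different directions exchange directions) or flipping the end (the last step of the path rotates by $90^\circ$). The transfer graph $G_m$ is the directed graph whose vertices are the pairs $(i,j)$ of integers in $\{0,\dots,m\}$ with $|i-j|\le 1$, with an edge $(i,j)\to(j,k)$ for all such vertices except when $j=i\pm1$ and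 $k=i$. Let $A_m$ be its adjacency matrix and $r_m$ the largest real root of $a_m(x)=\det(A_m-xI)$ (the Perron eigenvalue of $A_m$). $f(n)\sim g(n)$ means $f(n)/g(n)\to 1$. *)

theory Defs
  imports
    Complex_Main
    "HOL-Library.Product_Plus"
    "HOL-Library.Landau_Symbols"
    "Jordan_Normal_Form.Determinant"
begin

datatype step = North | South | East

fun disp :: "step \<Rightarrow> int \<times> int" where
  "disp North = (0, 1)"
| "disp South = (0, -1)"
| "disp East = (1, 0)"

definition strip :: "nat \<Rightarrow> (int \<times> int) set" where
  "strip m = {(x, y). 0 \<le> x \<and> 0 \<le> y \<and> y \<le> int m}"

text \<open>A lattice path starting at the origin is represented by its list of steps; the point it
  reaches after \<open>k\<close> steps is the sum of the first \<open>k\<close> displacements.\<close>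

definition point_after :: "step list \<Rightarrow> nat \<Rightarrow> int \<times> int" where
  "point_after p k = sum_list (map disp (take k p))"

definition retraces :: "step list \<Rightarrow> bool" where
  "retraces p \<longleftrightarrow>
     (\<exists>i. Suc i < length p \<and> (p ! i, p ! Suc i) \<in> {(North, South), (South, North)})"

definition monotone_path :: "nat \<Rightarrow> nat \<Rightarrow> step list \<Rightarrow> bool" where
  "monotone_path m n p \<longleftrightarrow>
     length p = n \<and> \<not> retraces p \<and> (\<forall>k\<le>n. point_after p k \<in> strip m)"

fun rot90 :: "int \<times> int \<Rightarrow> int \<times> int" where
  "rot90 (x, y) = (- y, x)"

text \<open>The two disjuncts in \<open>flip_end\<close> are the counterclockwise and the clockwise rotation of
  the last step.\<close>

inductive local_move :: "step list \<Rightarrow> step list \<Rightarrow> bool" where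
  switch_corner: "a \<noteq> b \<Longrightarrow> local_move (u @ [a, b] @ v) (u @ [b, a] @ v)"
| flip_end: "disp b = rot90 (disp a) \<or> disp a = rot90 (disp b) \<Longrightarrow> local_move (u @ [a]) (u @ [b])"

definition kernel_verts :: "nat \<Rightarrow> nat \<Rightarrow> step list set" where
  "kernel_verts m n = {p. monotone_path m n p}"

definition kernel_edges :: "nat \<Rightarrow> nat \<Rightarrow> step list set set" where
  "kernel_edges m n =
     {{p, q} | p q. p \<in> kernel_verts m n \<and> q \<in> kernel_verts m n \<and> local_move p q}"

definition transfer_verts :: "nat \<Rightarrow> (nat \<times> nat) set" where
  "transfer_verts m = {(i, j). i \<le> m \<and> j \<le> m \<and> \<bar>int i - int j\<bar> \<le> 1}"

definition transfer_edges :: "nat \<Rightarrow> ((nat \<times> nat) \<times> (nat \<times> nat)) set" where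
  "transfer_edges m =
     {((i, j), (j, k)) | i j k. (i, j) \<in> transfer_verts m \<and> (j, k) \<in> transfer_verts m \<and>
        \<not> (\<bar>int j - int i\<bar> = 1 \<and> k = i)}"

text \<open>Matrices are indexed by initial segments of the naturals, so the adjacency matrix is taken
  with respect to the lexicographic enumeration of the vertices.\<close>

definition transfer_list :: "nat \<Rightarrow> (nat \<times> nat) list" where
  "transfer_list m =
     filter (\<lambda>v. v \<in> transfer_verts m) (List.product [0..<Suc m] [0..<Suc m])"

lemma set_transfer_list: "set (transfer_list m) = transfer_verts m"
  by (auto simp: transfer_list_def transfer_verts_def)

lemma distinct_transfer_list: "distinct (transfer_list m)"
  by (simp add: transfer_list_def distinct_product)

definition transfer_matrix :: "nat \<Rightarrow> real mat" where
  "transfer_matrix m =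
     (let vs = transfer_list m; d = length vs
      in mat d d (\<lambda>(s, t). if (vs ! s, vs ! t) \<in> transfer_edges m then 1 else 0))"

definition transfer_charpoly :: "nat \<Rightarrow> real \<Rightarrow> real" where
  "transfer_charpoly m x =
     det (transfer_matrix m - x \<cdot>\<^sub>m 1\<^sub>m (dim_row (transfer_matrix m)))"

definition perron_root :: "nat \<Rightarrow> real" where
  "perron_root m = Max {x. transfer_charpoly m x = 0}"

definition C :: "nat \<Rightarrow> real" where
  "C m = 1 / ((perron_root m)\<^sup>2 * (perron_root m - 1)\<^sup>2)"

end

theory Submission
  imports Defs "Jordan_Normal_Form.Char_Poly"
begin

text \<open>Switching corners never changes the word of vertical steps of a path, and flipping the end only
  appends a letter to it or deletes its last one. Hence the \<open>n + 1\<close> paths with at most one vertical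
  step separate the paths whose vertical word starts with \<open>N S\<close> from those starting with \<open>N N\<close>. The
  former are \<open>E\<^sup>a N E\<^sup>b S\<close> with \<open>b \<ge> 1\<close>, followed by nothing or by \<open>E\<close> and an arbitrary path of the
  strip; as the number of paths of length \<open>n\<close> is asymptotic to a multiple of \<open>r\<^sup>n\<close>, their proportion
  tends to the sum of \<open>r\<close> to the power \<open>- (a + b + 3)\<close>, which is \<open>C m\<close>.

  The Perron root is found from an explicit positive eigenvector: its values at \<open>(j, j)\<close> satisfy a
  three-term recurrence, and the boundary conditions become an equation for the ratios of consecutive
  values. These ratios increase with \<open>x\<close>, so the intermediate value theorem yields the root for
  height \<open>m + 1\<close> strictly between the root for height \<open>m\<close> and \<open>1 + \<surd>2\<close>.\<close>

section \<open>Roots of the eigenvalue equation\<close>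

text \<open>With \<open>h j\<close> the value of an eigenvector at \<open>(j, j)\<close>, the eigenvector equation for \<open>x\<close> reduces to
  \<open>h (j + 1) + h (j - 1) = trace_fn x * h j\<close> with boundary conditions \<open>x * h (-1) = h 0\<close> and
  \<open>x * h (m + 1) = h m\<close>. So \<open>ratio x j\<close> stands for \<open>h j / h (j - 1)\<close>, and the top condition is the
  equation in \<open>is_root\<close>; above \<open>8/5\<close> the function \<open>trace_fn\<close> is increasing.\<close>

definition trace_fn :: "real \<Rightarrow> real" where
  "trace_fn x = x - 1 + 1 / x + 1 / x\<^sup>2"

fun ratio :: "real \<Rightarrow> nat \<Rightarrow> real" where
  "ratio x 0 = x"
| "ratio x (Suc j) = trace_fn x - 1 / ratio x j"

definition is_root :: "nat \<Rightarrow> real \<Rightarrow> bool" where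
  "is_root m x \<longleftrightarrow> 8/5 \<le> x \<and> x < 1 + sqrt 2 \<and> (\<forall>j\<le>m. 0 < ratio x j) \<and> ratio x (Suc m) = 1 / x"

text \<open>The difference quotient is \<open>1 - 1/(x y) - (1/x + 1/y)/(x y)\<close>; for arguments
  from \<open>8/5\<close> on, the subtracted terms add up to at most
  \<open>25/64 + 5/4 * 25/64 < 1\<close>.\<close>

lemma trace_fn_strict_mono:
  assumes "8/5 \<le> x" "x < y"
  shows "trace_fn x < trace_fn y"
proof -
  have pos: "0 < x" "0 < y" using assms by auto
  have xy: "(8/5) * (8/5) \<le> x * y" using assms by (intro mult_mono) auto
  have a: "1 / (x * y) \<le> 25/64" using xy pos by (simp add: field_simps)
  have b: "1 / x \<le> 5/8" "1 / y \<le> 5/8" using assms pos by (simp_all add: field_simps)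
  have c: "(1 / x + 1 / y) * (1 / (x * y)) \<le> (5/4) * (25/64)"
    using a b pos by (intro mult_mono) auto
  have "trace_fn y - trace_fn x = (y - x) * (1 - 1 / (x * y) - (1 / x + 1 / y) * (1 / (x * y)))"
    using pos by (simp add: trace_fn_def field_simps power2_eq_square)
  also have "\<dots> > 0"
    by (rule mult_pos_pos) (use a c assms in linarith)+
  finally show ?thesis by simp
qed

text \<open>The expression \<open>trace_fn x - 1/t\<close> increases in \<open>x\<close> and in
  positive \<open>t\<close>. Positivity is assumed at the smaller point, and the induction carries
  it over to the larger one.\<close>

lemma ratio_strict_mono:
  assumes "8/5 \<le> x" "x < y" "\<And>i. i < j \<Longrightarrow> 0 < ratio x i"
  shows "ratio x j < ratio y j"
  using assms(3)
proof (induction j)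
  case 0
  then show ?case using assms by simp
next
  case (Suc j)
  have "0 < ratio x j" "ratio x j < ratio y j" using Suc by auto
  then have "1 / ratio y j < 1 / ratio x j" by (simp add: frac_less2)
  then show ?case using trace_fn_strict_mono[OF assms(1,2)] by simp
qed

lemma ratio_pos_mono:
  assumes "8/5 \<le> x" "x \<le> y" "\<And>i. i \<le> j \<Longrightarrow> 0 < ratio x i"
  shows "0 < ratio y j"
  using ratio_strict_mono[of x y j] assms
  by (cases "x = y") (force simp: less_le intro: less_trans)+

lemma continuous_on_ratio:
  assumes "\<And>x. x \<in> S \<Longrightarrow> 0 < x" "\<And>x i. x \<in> S \<Longrightarrow> i < j \<Longrightarrow> 0 < ratio x i"
  shows "continuous_on S (\<lambda>x. ratio x j)"
  using assms(2)
proof (induction j)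
  case (Suc j)
  have "continuous_on S (\<lambda>x. ratio x j)" using Suc by auto
  moreover have "ratio x j \<noteq> 0" "x \<noteq> 0" if "x \<in> S" for x
    using Suc.prems[of x j] assms(1) that by force+
  ultimately show ?case
    by (auto simp: trace_fn_def intro!: continuous_intros)
qed auto

text \<open>The threshold of the recurrence: at trace \<open>2\<close> all ratios stay above
  \<open>1\<close> (\<open>ratio_limit\<close>), whereas for smaller trace some ratio fails to be
  positive (\<open>ratio_upper\<close>).\<close>

lemma trace_fn_limit: "trace_fn (1 + sqrt 2) = 2"
proof -
  have i: "1 / (1 + sqrt 2) = sqrt 2 - 1"
    by (simp add: field_simps add_nonneg_eq_0_iff)
  have "1 / (1 + sqrt 2)\<^sup>2 = (1 / (1 + sqrt 2))\<^sup>2"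
    by (simp add: power_divide)
  also have "\<dots> = 3 - 2 * sqrt 2"
    unfolding i by (simp add: power2_eq_square algebra_simps)
  finally show ?thesis
    by (simp only: trace_fn_def i)
qed

lemma ratio_limit: "1 < ratio (1 + sqrt 2) j"
  by (induction j) (auto simp: trace_fn_limit)

text \<open>Ratios that are positive at the old root stay positive to its right, so \<open>F\<close>
  has no pole up to \<open>1 + sqrt 2\<close> and the zero found there inherits the positivity
  demanded by \<open>is_root\<close>.\<close>

lemma is_root_Suc:
  assumes "is_root m x"
  obtains y where "x < y" "is_root (Suc m) y"
proof -
  define F where "F y = ratio y (Suc (Suc m)) - 1 / y" for y
  let ?S = "{x..1 + sqrt 2}"
  have x: "8/5 \<le> x" "x < 1 + sqrt 2" "\<And>j. j \<le> m \<Longrightarrow> 0 < ratio x j"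
    "ratio x (Suc m) = 1 / x"
    using assms by (auto simp: is_root_def)
  have x_pos: "0 < ratio x j" if "j \<le> Suc m" for j
    using x that by (cases "j = Suc m") auto
  have pos: "0 < ratio y j" if "x \<le> y" "j \<le> Suc m" for y j
    using ratio_pos_mono[of x y j] x(1) x_pos that by simp
  have "continuous_on ?S F"
    unfolding F_def using x(1) pos
    by (intro continuous_intros continuous_on_ratio) auto
  \<comment> \<open>At the old root \<open>ratio x (Suc m) = 1/x\<close>, so the next ratio is
    \<open>trace_fn x - x\<close> and \<open>F x = 1/x^2 - 1\<close>.\<close>
  moreover have Fx: "F x < 0"
  proof -
    have "1 < x * x" using x(1) by (auto intro: less_1_mult)
    then have "1 / x\<^sup>2 < 1" by (simp add: power2_eq_square)
    then show ?thesis using x(1) by (simp add: F_def x(4) trace_fn_def del: ratio.simps(2) add: ratio.simps(2)[of x "Suc m"])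
  qed
  moreover have FL: "0 < F (1 + sqrt 2)"
  proof -
    have "1 / (1 + sqrt 2) < 1" by (simp add: field_simps add_pos_pos)
    then show ?thesis using ratio_limit[of "Suc (Suc m)"] by (simp add: F_def del: ratio.simps(2))
  qed
  ultimately obtain y where y: "x \<le> y" "y \<le> 1 + sqrt 2" "F y = 0"
    using IVT'[of F x 0 "1 + sqrt 2"] x(2) by auto
  then have "x < y" "y < 1 + sqrt 2" using Fx FL by (auto simp: less_le)
  then show ?thesis
    using that[of y] x(1) pos y(3)
    by (auto simp: is_root_def F_def simp del: ratio.simps(2))
qed

text \<open>Since \<open>x^2 = x + 1\<close>, \<open>trace_fn x = x\<close> and the ratios are
  \<open>x\<close>, \<open>1\<close>, \<open>x - 1 = 1/x\<close>. The golden ratio lies just above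
  \<open>8/5\<close>, so the lower bound in \<open>is_root\<close> holds from height 1 on.\<close>

lemma golden_is_root: "is_root 1 ((1 + sqrt 5) / 2)"
proof -
  define x :: real where "x = (1 + sqrt 5) / 2"
  have "11 / 5 \<le> sqrt 5" by (rule real_le_rsqrt) (simp add: power2_eq_square)
  then have x: "8/5 \<le> x" by (simp add: x_def)
  have sq: "x * x = x + 1" by (simp add: x_def field_simps)
  have i: "1 / x = x - 1" using x sq by (simp add: field_simps)
  have "1 / x\<^sup>2 = (1 / x)\<^sup>2" by (simp add: power_divide)
  also have "\<dots> = 2 - x" unfolding i using sq by (simp add: power2_eq_square algebra_simps)
  finally have i2: "1 / x\<^sup>2 = 2 - x" .
  have s: "trace_fn x = x" by (simp add: trace_fn_def i i2)
  have "sqrt 5 < 1 + 2 * sqrt 2"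
  proof (rule real_less_lsqrt)
    show "5 < (1 + 2 * sqrt 2)\<^sup>2" by (simp add: power2_eq_square algebra_simps add_pos_pos)
  qed auto
  then have "x < 1 + sqrt 2" by (simp add: x_def)
  moreover have "ratio x 1 = 1" "ratio x 2 = x - 1" "ratio x 0 = x"
    by (simp_all add: s i numeral_2_eq_2)
  ultimately show ?thesis
    unfolding x_def[symmetric] using x i
    by (auto simp: is_root_def le_Suc_eq numeral_2_eq_2 simp del: ratio.simps)
qed

lemma is_root_ex: "m \<ge> 1 \<Longrightarrow> \<exists>x. is_root m x"
proof (induction m rule: dec_induct)
  case base
  then show ?case using golden_is_root by blast
next
  case (step n)
  then show ?case using is_root_Suc by metis
qed

text \<open>A sign test for locating the root. Monotonicity is applied from the smaller point of the
  refuted case, which is the root here and \<open>b\<close> in \<open>is_root_upper\<close>;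
  positivity of the ratios is required there.\<close>

lemma is_root_lower:
  assumes "is_root m x" "ratio a (Suc m) < 1 / a" "0 < a"
  shows "a < x"
proof (rule ccontr)
  assume "\<not> a < x"
  then have le: "x \<le> a" by simp
  have "ratio x (Suc m) \<le> ratio a (Suc m)"
    using ratio_strict_mono[of x a "Suc m"] assms(1) le
    by (cases "x = a") (auto simp: is_root_def simp del: ratio.simps(2))
  moreover have "1 / a \<le> 1 / x" using le assms(1) by (auto simp: is_root_def intro!: divide_left_mono)
  ultimately show False using assms by (simp add: is_root_def)
qed

lemma is_root_upper:
  assumes "is_root m x" "1 / b < ratio b (Suc m)" "8/5 \<le> b" "\<And>j. j \<le> m \<Longrightarrow> 0 < ratio b j"
  shows "x < b"
proof (rule ccontr)
  assume "\<not> x < b"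
  then have le: "b \<le> x" by simp
  have "ratio b (Suc m) \<le> ratio x (Suc m)"
    using ratio_strict_mono[of b x "Suc m"] assms le
    by (cases "x = b") (auto simp: simp del: ratio.simps(2))
  moreover have "1 / x \<le> 1 / b" using le assms(3) by (auto intro!: divide_left_mono)
  ultimately show False using assms by (simp add: is_root_def)
qed

text \<open>As \<open>t + 1 / t \<ge> 2\<close>, every step of the recursion lowers a positive ratio by at least
  \<open>2 - trace_fn x\<close>; so the ratios can only stay positive forever if \<open>trace_fn x \<ge> 2\<close>.\<close>

lemma ratio_upper:
  assumes "\<And>i. i < j \<Longrightarrow> 0 < ratio x i"
  shows "ratio x j \<le> x - real j * (2 - trace_fn x)"
  using assms
proof (induction j)
  case (Suc j)
  have p: "0 < ratio x j" using Suc by auto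
  have "0 \<le> (ratio x j - 1)\<^sup>2 / ratio x j" using p by simp
  also have "\<dots> = ratio x j + 1 / ratio x j - 2" using p by (simp add: field_simps power2_eq_square)
  finally have "2 \<le> ratio x j + 1 / ratio x j" by simp
  moreover have "ratio x j \<le> x - real j * (2 - trace_fn x)" using Suc by auto
  ultimately show ?case by (simp add: algebra_simps)
qed simp

text \<open>The roots increase to some \<open>l\<close>. As \<open>l\<close> bounds the roots for
  all heights, every ratio at \<open>l\<close> is positive; if \<open>l\<close> were below
  \<open>1 + sqrt 2\<close>, then \<open>trace_fn l < 2\<close> and \<open>ratio_upper\<close> would
  force a negative ratio.\<close>

lemma is_root_limit:
  assumes "\<And>m. m \<ge> 1 \<Longrightarrow> is_root m (r m)" "\<And>m. m \<ge> 1 \<Longrightarrow> r m < r (Suc m)"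
  shows "r \<longlonglongrightarrow> 1 + sqrt 2"
proof -
  have "incseq (\<lambda>n. r (Suc n))"
    using assms(2) by (intro incseq_SucI) (simp add: less_imp_le)
  moreover have bd: "r (Suc n) \<le> 1 + sqrt 2" for n
    using assms(1)[of "Suc n"] by (auto simp: is_root_def)
  ultimately obtain l where l: "(\<lambda>n. r (Suc n)) \<longlonglongrightarrow> l" "\<And>n. r (Suc n) \<le> l"
    using incseq_convergent by blast
  have le: "l \<le> 1 + sqrt 2" using l(1) bd by (intro LIMSEQ_le_const2) auto
  have "\<not> l < 1 + sqrt 2"
  proof
    assume lt: "l < 1 + sqrt 2"
    have l8: "8/5 \<le> l" using assms(1)[of 1] l(2)[of 0] by (simp add: is_root_def)
    have pos_l: "0 < ratio l j" for j
    proof (rule ratio_pos_mono)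
      have "is_root (Suc j) (r (Suc j))" using assms(1) by simp
      then show "8/5 \<le> r (Suc j)" "\<And>i. i \<le> j \<Longrightarrow> 0 < ratio (r (Suc j)) i"
        by (simp_all add: is_root_def)
      show "r (Suc j) \<le> l" by (rule l(2))
    qed
    have pos: "0 < l - real j * (2 - trace_fn l)" for j
      by (rule less_le_trans[OF pos_l ratio_upper]) (rule pos_l)
    have "0 < 2 - trace_fn l" using trace_fn_strict_mono[OF l8 lt] by (simp add: trace_fn_limit)
    then obtain j where "l < real j * (2 - trace_fn l)" using reals_Archimedean3 by blast
    then show False using pos[of j] by simp
  qed
  then have "l = 1 + sqrt 2" using le by simp
  then show ?thesis using l(1) by (simp add: filterlim_sequentially_Suc)
qed

section \<open>The Perron eigenvector\<close>

lemma finite_transfer_verts: "finite (transfer_verts m)"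
  by (rule finite_subset[of _ "{..m} \<times> {..m}"]) (auto simp: transfer_verts_def)

lemma sum_nth_transfer_list:
  "(\<Sum>i = 0..<length (transfer_list m). F (transfer_list m ! i)) = (\<Sum>v\<in>transfer_verts m. F v)"
  using sum.reindex_bij_betw[OF bij_betw_nth[OF distinct_transfer_list refl refl], of F m]
  by (simp add: set_transfer_list atLeast0LessThan)

lemma transfer_edges_Image_subset: "transfer_edges m `` {s} \<subseteq> transfer_verts m"
  by (auto simp: transfer_edges_def)

lemma finite_transfer_edges_Image: "finite (transfer_edges m `` {s})"
  using finite_transfer_verts transfer_edges_Image_subset by (rule finite_subset[rotated])

lemma transfer_matrix_carrier:
  "transfer_matrix m \<in> carrier_mat (length (transfer_list m)) (length (transfer_list m))"
  by (simp add: transfer_matrix_def Let_def)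

lemma transfer_matrix_mult_vec:
  assumes i: "i < length (transfer_list m)"
    and w: "\<And>j. j < length (transfer_list m) \<Longrightarrow> w $ j = f (transfer_list m ! j)"
    and dim: "dim_vec w = length (transfer_list m)"
  shows "(transfer_matrix m *\<^sub>v w) $ i = (\<Sum>t\<in>transfer_edges m `` {transfer_list m ! i}. f t)"
proof -
  let ?L = "transfer_list m"
  have "(transfer_matrix m *\<^sub>v w) $ i =
    (\<Sum>j = 0..<length ?L. (if (?L ! i, ?L ! j) \<in> transfer_edges m then f (?L ! j) else 0))"
    using i w dim
    by (auto simp: transfer_matrix_def Let_def scalar_prod_def intro!: sum.cong)
  also have "\<dots> = (\<Sum>t\<in>transfer_verts m. (if (?L ! i, t) \<in> transfer_edges m then f t else 0))"
    by (rule sum_nth_transfer_list)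
  also have "\<dots> = (\<Sum>t\<in>transfer_edges m `` {?L ! i}. f t)"
    using transfer_edges_Image_subset[of m "?L ! i"] finite_transfer_verts[of m]
    by (intro sum.mono_neutral_cong_right) auto
  finally show ?thesis .
qed

lemma transfer_charpoly_eq_0_iff_eigenvalue:
  "transfer_charpoly m x = 0 \<longleftrightarrow> eigenvalue (transfer_matrix m) x"
proof -
  have "transfer_matrix m - x \<cdot>\<^sub>m 1\<^sub>m (dim_row (transfer_matrix m)) = char_matrix (transfer_matrix m) x"
    using transfer_matrix_carrier[of m] by (intro eq_matI) (auto simp: char_matrix_def)
  then show ?thesis
    using eigenvalue_det[OF transfer_matrix_carrier] by (simp add: transfer_charpoly_def)
qed

text \<open>Replaces vectors indexed by the enumeration by functions on the vertices, so that
  eigenvectors can be treated vertex by vertex.\<close>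

lemma transfer_charpoly_eq_0_iff:
  "transfer_charpoly m x = 0 \<longleftrightarrow>
     (\<exists>f. (\<exists>s\<in>transfer_verts m. f s \<noteq> 0) \<and>
          (\<forall>s\<in>transfer_verts m. (\<Sum>t\<in>transfer_edges m `` {s}. f t) = x * f s))"
  (is "_ \<longleftrightarrow> (\<exists>f. ?P f)")
proof -
  let ?L = "transfer_list m" and ?A = "transfer_matrix m"
  have dimA: "dim_row ?A = length ?L" using transfer_matrix_carrier[of m] by auto
  have nth: "\<exists>i<length ?L. ?L ! i = s" if "s \<in> transfer_verts m" for s
    using that by (simp add: in_set_conv_nth flip: set_transfer_list)
  have nth': "?L ! i \<in> transfer_verts m" if "i < length ?L" for i
    using that by (simp flip: set_transfer_list)
  show ?thesis unfolding transfer_charpoly_eq_0_iff_eigenvalue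
  proof
    assume "eigenvalue ?A x"
    then obtain w where w: "dim_vec w = length ?L" "w \<noteq> 0\<^sub>v (length ?L)" "?A *\<^sub>v w = x \<cdot>\<^sub>v w"
      unfolding eigenvalue_def eigenvector_def dimA by (metis carrier_vecD)
    \<comment> \<open>The enumeration is distinct, so \<open>SOME\<close> picks the only index of
      \<open>s\<close>.\<close>
    define f where "f s = w $ (SOME i. i < length ?L \<and> ?L ! i = s)" for s
    have f: "w $ j = f (?L ! j)" if "j < length ?L" for j
    proof -
      have "(SOME i. i < length ?L \<and> ?L ! i = ?L ! j) = j"
        using that distinct_transfer_list[of m] by (auto simp: nth_eq_iff_index_eq)
      then show ?thesis by (simp add: f_def)
    qed
    have "\<exists>s\<in>transfer_verts m. f s \<noteq> 0"
    proof (rule ccontr)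
      assume "\<not> ?thesis"
      then have "w = 0\<^sub>v (length ?L)" using w(1) f nth' by (intro eq_vecI) auto
      then show False using w(2) by simp
    qed
    moreover have "(\<Sum>t\<in>transfer_edges m `` {s}. f t) = x * f s" if s: "s \<in> transfer_verts m" for s
    proof -
      obtain i where i: "i < length ?L" "?L ! i = s" using nth s by blast
      have "(\<Sum>t\<in>transfer_edges m `` {s}. f t) = (?A *\<^sub>v w) $ i"
        using transfer_matrix_mult_vec[OF i(1) f w(1)] i(2) by simp
      then show ?thesis using i f[of i] w by simp
    qed
    ultimately show "\<exists>f. ?P f" by blast
  next
    assume "\<exists>f. ?P f"
    then obtain f where f: "?P f" by blast
    define w where "w = vec (length ?L) (\<lambda>i. f (?L ! i))"
    have wj: "w $ j = f (?L ! j)" if "j < length ?L" for j using that by (simp add: w_def)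
    have dw: "dim_vec w = length ?L" by (simp add: w_def)
    obtain s where s: "s \<in> transfer_verts m" "f s \<noteq> 0" using f by blast
    obtain i where i: "i < length ?L" "?L ! i = s" using nth s by blast
    have "w $ i \<noteq> 0" using wj[OF i(1)] i(2) s by simp
    then have "w \<noteq> 0\<^sub>v (length ?L)" using i by auto
    moreover have "?A *\<^sub>v w = x \<cdot>\<^sub>v w"
    proof (rule eq_vecI)
      fix i assume "i < dim_vec (x \<cdot>\<^sub>v w)"
      then have i: "i < length ?L" by (simp add: dw)
      have "(?A *\<^sub>v w) $ i = (\<Sum>t\<in>transfer_edges m `` {?L ! i}. f t)"
        by (rule transfer_matrix_mult_vec[OF i wj dw])
      then show "(?A *\<^sub>v w) $ i = (x \<cdot>\<^sub>v w) $ i" using f nth'[OF i] wj[OF i] i dw by simp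
    qed (simp add: dw dimA)
    ultimately have "eigenvector ?A w x"
      by (auto simp: eigenvector_def dimA dw intro!: carrier_vecI)
    then show "eigenvalue ?A x" by (auto simp: eigenvalue_def)
  qed
qed

text \<open>Guarantees that \<open>Max\<close> in \<open>perron_root\<close> is taken over a finite
  set.\<close>

lemma finite_transfer_charpoly_roots: "finite {x. transfer_charpoly m x = 0}"
proof -
  let ?p = "char_poly (transfer_matrix m)"
  have "?p \<noteq> 0" using degree_monic_char_poly[OF transfer_matrix_carrier[of m]] by auto
  then have "finite {x. poly ?p x = 0}" by (rule poly_roots_finite)
  then show ?thesis
    by (simp add: transfer_charpoly_eq_0_iff_eigenvalue
        eigenvalue_root_char_poly[OF transfer_matrix_carrier])
qed

text \<open>A positive eigenvector belongs to the largest real eigenvalue: for another eigenpair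
  \<open>(x, f)\<close>, evaluate at a vertex \<open>s\<close> maximizing
  \<open>\<bar>f s\<bar> / v s\<close> and compare \<open>\<bar>f\<bar>\<close> with
  \<open>k * v\<close> on its successors.\<close>

lemma perron_root_eqI:
  assumes pos: "\<And>s. s \<in> transfer_verts m \<Longrightarrow> 0 < v s"
    and eig: "\<And>s. s \<in> transfer_verts m \<Longrightarrow> (\<Sum>t\<in>transfer_edges m `` {s}. v t) = r * v s"
  shows "perron_root m = r"
proof -
  let ?V = "transfer_verts m"
  have ne: "(0, 0) \<in> ?V" by (simp add: transfer_verts_def)
  show ?thesis unfolding perron_root_def
  proof (rule Max_eqI[OF finite_transfer_charpoly_roots])
    show "r \<in> {x. transfer_charpoly m x = 0}"
      using ne pos[OF ne] eig unfolding mem_Collect_eq transfer_charpoly_eq_0_iff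
      by (intro exI[of _ v] conjI bexI[OF _ ne]) auto
  next
    fix x assume "x \<in> {x. transfer_charpoly m x = 0}"
    then obtain f where f: "\<exists>s\<in>?V. f s \<noteq> 0"
      "\<And>s. s \<in> ?V \<Longrightarrow> (\<Sum>t\<in>transfer_edges m `` {s}. f t) = x * f s"
      by (auto simp: transfer_charpoly_eq_0_iff)
    let ?q = "\<lambda>s. \<bar>f s\<bar> / v s"
    define k where "k = Max (?q ` ?V)"
    have fin: "finite (?q ` ?V)" using finite_transfer_verts by simp
    have "k \<in> ?q ` ?V" unfolding k_def using fin ne by (intro Max_in) auto
    then obtain s where s: "s \<in> ?V" "k = ?q s" by blast
    have le: "\<bar>f t\<bar> \<le> k * v t" if "t \<in> ?V" for t
    proof -
      have "?q t \<le> k" unfolding k_def using fin that by (intro Max_ge) auto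
      then show ?thesis using pos[OF that] by (simp add: field_simps)
    qed
    have kpos: "0 < k"
    proof -
      obtain t where t: "t \<in> ?V" "f t \<noteq> 0" using f(1) by blast
      have "0 < k * v t" using le[OF t(1)] t(2) by linarith
      then show ?thesis using pos[OF t(1)] by (simp add: zero_less_mult_iff)
    qed
    have fs: "\<bar>f s\<bar> = k * v s" using s pos[OF s(1)] by simp
    have "x * \<bar>f s\<bar> \<le> \<bar>x * f s\<bar>" by (simp add: abs_mult mult_right_mono)
    also have "\<dots> = \<bar>\<Sum>t\<in>transfer_edges m `` {s}. f t\<bar>" using f(2) s by simp
    also have "\<dots> \<le> (\<Sum>t\<in>transfer_edges m `` {s}. \<bar>f t\<bar>)" by (rule sum_abs)
    also have "\<dots> \<le> (\<Sum>t\<in>transfer_edges m `` {s}. k * v t)"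
      using transfer_edges_Image_subset le by (intro sum_mono) blast
    also have "\<dots> = r * \<bar>f s\<bar>" using eig[OF s(1)] fs by (simp flip: sum_distrib_left)
    finally show "x \<le> r" using kpos pos[OF s(1)] by (simp add: fs)
  qed
qed

text \<open>\<open>i = Suc j\<close> means that the last step went down, so going up is barred;
  \<open>Suc i = j\<close> is the mirror case. The general codomain serves both real eigenvectors
  and natural cardinalities.\<close>

lemma sum_transfer_edges_Image:
  assumes "(i, j) \<in> transfer_verts m"
  shows "(\<Sum>t\<in>transfer_edges m `` {(i, j)}. f t) =
    f (j, j) + (if j < m \<and> i \<noteq> Suc j then f (j, Suc j) else 0)
             + (if 0 < j \<and> Suc i \<noteq> j then f (j, j - 1) else (0 :: 'a :: comm_monoid_add))"
proof -
  define U D where "U = (if j < m \<and> i \<noteq> Suc j then {(j, Suc j)} else {})"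
    and "D = (if 0 < j \<and> Suc i \<noteq> j then {(j, j - 1)} else {})"
  have "transfer_edges m `` {(i, j)} = insert (j, j) (U \<union> D)"
    using assms by (auto simp: transfer_edges_def transfer_verts_def U_def D_def)
  moreover have "(j, j) \<notin> U \<union> D" "finite U" "finite D" "U \<inter> D = {}"
    by (auto simp: U_def D_def)
  ultimately have "(\<Sum>t\<in>transfer_edges m `` {(i, j)}. f t) = f (j, j) + (sum f U + sum f D)"
    by (simp add: sum.union_disjoint)
  then show ?thesis by (simp add: U_def D_def add.assoc)
qed

text \<open>\<open>level x (Suc j)\<close> is the eigenvector at \<open>(j, j)\<close>, and \<open>level x 0\<close> its value at the
  fictitious height \<open>-1\<close>. Eliminating the entries at \<open>(j, j \<plusminus> 1)\<close> from the eigenvector equation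
  leaves the three-term recurrence \<open>level_rec\<close>.\<close>

definition level :: "real \<Rightarrow> nat \<Rightarrow> real" where
  "level x j = (\<Prod>i<j. ratio x i)"

lemma level_simps: "level x 0 = 1" "level x (Suc 0) = x" "level x (Suc j) = ratio x j * level x j"
  by (simp_all add: level_def)

lemma level_rec:
  assumes "ratio x j \<noteq> 0"
  shows "level x (Suc (Suc j)) + level x j = trace_fn x * level x (Suc j)"
  using assms by (simp add: level_simps(3) field_simps)

text \<open>The off-diagonal formulas come from solving a linear system. With \<open>h\<close> on
  the diagonal, \<open>u\<close> at \<open>(j, j + 1)\<close> and \<open>d\<close> at
  \<open>(j + 1, j)\<close>, the eigenvector equations give \<open>x d = x h_j - u\<close> and
  \<open>d = x h_(j+1) - x u\<close>.\<close>

fun eigvec :: "real \<Rightarrow> nat \<times> nat \<Rightarrow> real" where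
  "eigvec x (i, j) =
     (if i = j then level x (Suc i)
      else if i < j then x * (x * level x (Suc (Suc i)) - level x (Suc i)) / (x\<^sup>2 - 1)
      else x * (x * level x i - level x (Suc i)) / (x\<^sup>2 - 1))"

context
  fixes m x assumes root: "is_root m x"
begin

lemma root_gt_1: "1 < x"
  using root by (simp add: is_root_def)

lemma root_sq_gt_1: "1 < x\<^sup>2"
  using root_gt_1 by simp

lemma level_pos: "j \<le> Suc m \<Longrightarrow> 0 < level x j"
  using root by (auto simp: level_def is_root_def intro!: prod_pos)

lemma level_rec_root:
  assumes "j \<le> m"
  shows "x\<^sup>2 * (level x (Suc (Suc j)) + level x j) = (x ^ 3 - x\<^sup>2 + x + 1) * level x (Suc j)"
proof -
  have "ratio x j \<noteq> 0" using root assms by (auto simp: is_root_def)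
  moreover have "x\<^sup>2 * trace_fn x = x ^ 3 - x\<^sup>2 + x + 1"
    using root_gt_1 by (simp add: trace_fn_def field_simps power2_eq_square power3_eq_cube)
  ultimately show ?thesis using level_rec[of x j] by (simp flip: mult.assoc)
qed

lemma level_top: "x * level x (Suc (Suc m)) = level x (Suc m)"
  using root root_gt_1 by (simp add: level_simps(3)[of x "Suc m"] is_root_def del: ratio.simps)

definition up :: "nat \<Rightarrow> real" where
  "up j = x * (x * level x (Suc (Suc j)) - level x (Suc j)) / (x\<^sup>2 - 1)"

definition down :: "nat \<Rightarrow> real" where
  "down j = x * (x * level x j - level x (Suc j)) / (x\<^sup>2 - 1)"

lemma sq_up: "(x\<^sup>2 - 1) * up j = x * (x * level x (Suc (Suc j)) - level x (Suc j))"
  using root_sq_gt_1 by (simp add: up_def)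

lemma sq_down: "(x\<^sup>2 - 1) * down j = x * (x * level x j - level x (Suc j))"
  using root_sq_gt_1 by (simp add: down_def)

text \<open>Both boundary conditions say that the entries leading out of the strip vanish (see
  \<open>down_0\<close>), so the interior equations hold at heights \<open>0\<close> and
  \<open>m\<close> as well.\<close>

lemma up_top: "up m = 0"
  using level_top by (simp add: up_def)

lemma down_0: "down 0 = 0"
  by (simp add: down_def level_simps)

text \<open>With \<open>up_step\<close> and \<open>down_step\<close>, this is the eigenvector
  equation at the three kinds of vertices. Multiplied by \<open>x^2 - 1\<close>, each reduces to
  \<open>level_rec_root\<close>.\<close>

lemma up_down:
  assumes "j \<le> m"
  shows "level x (Suc j) + up j + down j = x * level x (Suc j)"
proof -
  have "(x\<^sup>2 - 1) * (up j + down j) = x\<^sup>2 * (level x (Suc (Suc j)) + level x j) - 2 * x * level x (Suc j)"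
    unfolding distrib_left sq_up sq_down by (simp add: algebra_simps power2_eq_square)
  also have "\<dots> = (x\<^sup>2 - 1) * ((x - 1) * level x (Suc j))"
    unfolding level_rec_root[OF assms] by (simp add: algebra_simps power2_eq_square power3_eq_cube)
  finally have "up j + down j = (x - 1) * level x (Suc j)" using root_sq_gt_1 by simp
  then show ?thesis by (simp add: algebra_simps)
qed

lemma up_step:
  assumes "Suc j \<le> m"
  shows "level x (Suc (Suc j)) + up (Suc j) = x * up j"
proof -
  have "(x\<^sup>2 - 1) * (level x (Suc (Suc j)) + up (Suc j) - x * up j) =
    (x\<^sup>2 - 1) * level x (Suc (Suc j)) + (x\<^sup>2 - 1) * up (Suc j) - x * ((x\<^sup>2 - 1) * up j)"
    by (simp add: algebra_simps)
  also have "\<dots> =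
    (x\<^sup>2 - 1) * level x (Suc (Suc j)) + x\<^sup>2 * (level x (Suc (Suc (Suc j))) + level x (Suc j))
      - x * level x (Suc (Suc j)) - x ^ 3 * level x (Suc (Suc j))"
    unfolding sq_up by (simp add: algebra_simps power2_eq_square power3_eq_cube)
  also have "\<dots> = 0"
    unfolding level_rec_root[OF assms] by (simp add: algebra_simps power2_eq_square power3_eq_cube)
  finally show ?thesis using root_sq_gt_1 by simp
qed

lemma down_step:
  assumes "j \<le> m"
  shows "level x (Suc j) + down j = x * down (Suc j)"
proof -
  have "(x\<^sup>2 - 1) * (level x (Suc j) + down j - x * down (Suc j)) =
    (x\<^sup>2 - 1) * level x (Suc j) + (x\<^sup>2 - 1) * down j - x * ((x\<^sup>2 - 1) * down (Suc j))"
    by (simp add: algebra_simps)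
  also have "\<dots> =
    (x\<^sup>2 - 1) * level x (Suc j) + x\<^sup>2 * (level x (Suc (Suc j)) + level x j)
      - x * level x (Suc j) - x ^ 3 * level x (Suc j)"
    unfolding sq_down by (simp add: algebra_simps power2_eq_square power3_eq_cube)
  also have "\<dots> = 0"
    unfolding level_rec_root[OF assms] by (simp add: algebra_simps power2_eq_square power3_eq_cube)
  finally show ?thesis using root_sq_gt_1 by simp
qed

text \<open>Positivity spreads upwards from \<open>down 0 = 0\<close> by \<open>down_step\<close>;
  for \<open>up\<close> it spreads downwards from \<open>up m = 0\<close> by
  \<open>up_step\<close>.\<close>

lemma down_pos: "Suc j \<le> m \<Longrightarrow> 0 < down (Suc j)"
proof (induction j)
  case 0
  then show ?case
    using down_step[of 0] level_pos[of "Suc 0"] root_gt_1 by (simp add: down_0 zero_less_mult_iff)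
next
  case (Suc j)
  have "0 < x * down (Suc (Suc j))"
    using down_step[of "Suc j"] level_pos[of "Suc (Suc j)"] Suc by auto
  then show ?case using root_gt_1 by (simp add: zero_less_mult_iff)
qed

lemma up_nonneg: "j \<le> m \<Longrightarrow> 0 \<le> up j"
proof (induction j rule: inc_induct)
  case (step j)
  have "0 \<le> x * up j"
    using up_step[of j] level_pos[of "Suc (Suc j)"] step by auto
  then show ?case using root_gt_1 by (simp add: zero_le_mult_iff)
qed (simp add: up_top)

lemma up_pos:
  assumes "j < m"
  shows "0 < up j"
proof -
  have "0 < x * up j"
    using up_step[of j] level_pos[of "Suc (Suc j)"] up_nonneg[of "Suc j"] assms by auto
  then show ?thesis using root_gt_1 by (simp add: zero_less_mult_iff)
qed

lemma eigvec_simps: "eigvec x (j, j) = level x (Suc j)" "eigvec x (j, Suc j) = up j"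
  "eigvec x (Suc j, j) = down (Suc j)"
  by (simp_all add: up_def down_def)

lemma transfer_verts_cases:
  assumes "s \<in> transfer_verts m"
  obtains j where "j \<le> m" "s = (j, j)" | j where "j < m" "s = (j, Suc j)" | j where "j < m" "s = (Suc j, j)"
proof -
  obtain i j where s: "s = (i, j)" by force
  have "i \<le> m" "j \<le> m" "i = j \<or> j = Suc i \<or> i = Suc j"
    using assms by (auto simp: s transfer_verts_def)
  then show ?thesis using that by (auto simp: s)
qed

lemma eigvec_pos:
  assumes "s \<in> transfer_verts m"
  shows "0 < eigvec x s"
  using assms
  by (cases rule: transfer_verts_cases)
    (auto simp: eigvec_simps level_pos up_pos down_pos simp del: eigvec.simps)

lemma eigvec_sum:
  assumes s: "s \<in> transfer_verts m"
  shows "(\<Sum>t\<in>transfer_edges m `` {s}. eigvec x t) = x * eigvec x s"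
  using s
proof (cases rule: transfer_verts_cases)
  case (1 j)
  have "(if 0 < j then eigvec x (j, j - 1) else 0) = down j"
    by (cases j) (simp_all add: down_0 eigvec_simps del: eigvec.simps)
  moreover have "(if j < m then eigvec x (j, Suc j) else 0) = up j"
    using 1 up_top by (cases "j = m") (simp_all add: eigvec_simps del: eigvec.simps)
  ultimately show ?thesis
    using s up_down[OF 1(1)] unfolding 1
    by (subst sum_transfer_edges_Image) (simp_all add: eigvec_simps(1) del: eigvec.simps if_split)
next
  case (2 j)
  have "(if Suc j < m then eigvec x (Suc j, Suc (Suc j)) else 0) = up (Suc j)"
    using 2 up_top by (cases "Suc j = m") (simp_all add: eigvec_simps del: eigvec.simps)
  then show ?thesis
    using s up_step[of j] 2(1) unfolding 2(2)
    by (subst sum_transfer_edges_Image) (simp_all add: eigvec_simps(1,2) del: eigvec.simps if_split)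
next
  case (3 j)
  have "(if 0 < j then eigvec x (j, j - 1) else 0) = down j"
    by (cases j) (simp_all add: down_0 eigvec_simps del: eigvec.simps)
  then show ?thesis
    using s down_step[of j] 3 by (simp add: 3 sum_transfer_edges_Image eigvec_simps del: eigvec.simps)
qed

lemma perron_root_eq: "perron_root m = x"
  using eigvec_pos eigvec_sum by (rule perron_root_eqI)

text \<open>After a step down to height 0 only East is possible, so \<open>(0, 0)\<close> is the
  sole successor of \<open>(1, 0)\<close>.\<close>

lemma eigvec_ratio: "2 \<le> m \<Longrightarrow> eigvec x (1, 0) = eigvec x (0, 0) / x"
  using down_step[of 0] root_gt_1 eigvec_simps(3)[of 0]
  by (simp add: down_0 eigvec_simps(1) field_simps del: eigvec.simps)

end

section \<open>Monotonicity, bounds and limit of the constants \<open>C m\<close>\<close>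

lemma is_root_perron_root: "1 \<le> m \<Longrightarrow> is_root m (perron_root m)"
  using is_root_ex perron_root_eq by metis

lemma perron_root_less_Suc: "1 \<le> m \<Longrightarrow> perron_root m < perron_root (Suc m)"
  using is_root_Suc[OF is_root_perron_root] perron_root_eq by metis

text \<open>The decimals are chosen close enough to yield three digits of \<open>C 2\<close> in
  \<open>C_2_bounds\<close>.\<close>

lemma perron_root_2_bounds: "1.8965 < perron_root 2" "perron_root 2 < 1.8973"
proof -
  have root: "is_root 2 (perron_root 2)" by (rule is_root_perron_root) simp
  have ratio: "ratio x (Suc 0) = x - 1 + 1 / x\<^sup>2"
    "ratio x 2 = trace_fn x - 1 / ratio x (Suc 0)" "ratio x (Suc 2) = trace_fn x - 1 / ratio x 2" for x
    by (simp_all add: numeral_2_eq_2 trace_fn_def)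
  show "1.8965 < perron_root 2"
  proof (rule is_root_lower[OF root])
    show "ratio 1.8965 (Suc 2) < 1 / 1.8965"
      unfolding ratio trace_fn_def by (simp add: power2_eq_square)
  qed simp
  show "perron_root 2 < 1.8973"
  proof (rule is_root_upper[OF root])
    show "1 / 1.8973 < ratio 1.8973 (Suc 2)"
      unfolding ratio trace_fn_def by (simp add: power2_eq_square)
    fix j :: nat assume "j \<le> 2"
    then consider "j = 0" | "j = Suc 0" | "j = 2" by linarith
    then show "0 < ratio 1.8973 j"
      by cases (simp_all only: ratio ratio.simps(1) trace_fn_def, simp_all add: power2_eq_square)
  qed simp
qed

lemma C_strict_anti:
  assumes "1 \<le> m"
  shows "C (Suc m) < C m"
proof -
  let ?r = "perron_root m" and ?s = "perron_root (Suc m)"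
  have r: "1 < ?r" using is_root_perron_root[OF assms] by (rule root_gt_1)
  have lt: "?r < ?s" using assms by (rule perron_root_less_Suc)
  have "?r\<^sup>2 * (?r - 1)\<^sup>2 < ?s\<^sup>2 * (?s - 1)\<^sup>2"
    using r lt by (intro mult_strict_mono power_strict_mono) auto
  then show ?thesis using r by (auto simp: C_def intro!: frac_less2)
qed

lemma C_2_bounds: "0.345 \<le> C 2" "C 2 < 0.346"
proof -
  let ?r = "perron_root 2"
  have C: "C 2 = (1 / (?r * (?r - 1)))\<^sup>2" by (simp add: C_def power_divide power_mult_distrib)
  have r: "1.8965 < ?r" "?r < 1.8973" using perron_root_2_bounds by auto
  have "1.8965 * (1.8965 - 1) < ?r * (?r - 1)" "?r * (?r - 1) < 1.8973 * (1.8973 - 1)"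
    using r by (intro mult_strict_mono; simp)+
  then have *: "1 / (1.8973 * (1.8973 - 1)) < 1 / (?r * (?r - 1))"
      "1 / (?r * (?r - 1)) < 1 / (1.8965 * (1.8965 - 1))"
    using r by (intro frac_less2; simp)+
  have "(0.345::real) \<le> (1 / (1.8973 * (1.8973 - 1)))\<^sup>2" "(1 / (1.8965 * (1.8965 - 1)))\<^sup>2 < (0.346::real)"
    by (simp_all add: power2_eq_square)
  moreover have "(1 / (1.8973 * (1.8973 - 1)))\<^sup>2 \<le> C 2" "C 2 \<le> (1 / (1.8965 * (1.8965 - 1)))\<^sup>2"
    unfolding C using * r by (auto intro!: power_mono simp: less_imp_le)
  ultimately show "0.345 \<le> C 2" "C 2 < 0.346" by linarith+
qed

lemma C_limit: "C \<longlonglongrightarrow> 1.5 - sqrt 2"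
proof -
  define l where "l = (1 + sqrt 2)\<^sup>2 * (1 + sqrt 2 - 1)\<^sup>2"
  have l: "(1.5 - sqrt 2) * l = 1"
    by (simp add: l_def power2_eq_square algebra_simps)
  then have l0: "l \<noteq> 0" by (metis mult_zero_right zero_neq_one)
  have "perron_root \<longlonglongrightarrow> 1 + sqrt 2"
    using is_root_perron_root perron_root_less_Suc by (rule is_root_limit)
  then have "(\<lambda>m. (perron_root m)\<^sup>2 * (perron_root m - 1)\<^sup>2) \<longlonglongrightarrow> l"
    unfolding l_def by (intro tendsto_mult tendsto_power tendsto_diff tendsto_const)
  from tendsto_divide[OF tendsto_const[of 1] this l0] have "C \<longlonglongrightarrow> 1 / l"
    unfolding C_def .
  moreover have "1 / l = 1.5 - sqrt 2" using l l0 by (simp add: nonzero_divide_eq_eq)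
  ultimately show ?thesis by simp
qed

section \<open>Asymptotics of walk counts\<close>

text \<open>\<open>l / (1 - q)\<close> is the fixed point of the limiting recurrence; the deviation
  from it is contracted by \<open>q\<close> up to a perturbation tending to 0.\<close>

lemma affine_recurrence_limit:
  fixes x b :: "nat \<Rightarrow> real"
  assumes rec: "\<And>n. x (Suc n) = q * x n + b n" and q: "0 \<le> q" "q < 1" and b: "b \<longlonglongrightarrow> l"
  shows "x \<longlonglongrightarrow> l / (1 - q)"
proof -
  define y where "y n = x n - l / (1 - q)" for n
  have y: "y (Suc n) = q * y n + (b n - l)" for n
    using q by (simp add: y_def rec field_simps)
  have "y \<longlonglongrightarrow> 0"
  proof (rule LIMSEQ_I)
    fix e :: real assume e: "0 < e"
    \<comment> \<open>Chosen so that \<open>q * (e / 2) + d = e / 2\<close>: the recurrence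
      reproduces the error term.\<close>
    define d where "d = e / 2 * (1 - q)"
    have d: "0 < d" using e q by (simp add: d_def)
    obtain N where N: "\<And>n. n \<ge> N \<Longrightarrow> \<bar>b n - l\<bar> < d"
      using LIMSEQ_D[OF b d] by auto
    have bound: "\<bar>y (N + k)\<bar> \<le> q ^ k * \<bar>y N\<bar> + e / 2" for k
    proof (induction k)
      case 0
      then show ?case using e by simp
    next
      case (Suc k)
      have "\<bar>y (N + Suc k)\<bar> \<le> q * \<bar>y (N + k)\<bar> + \<bar>b (N + k) - l\<bar>"
        using y[of "N + k"] q(1) abs_triangle_ineq[of "q * y (N + k)" "b (N + k) - l"] by (simp add: abs_mult)
      also have "\<dots> \<le> q * (q ^ k * \<bar>y N\<bar> + e / 2) + d"
        using N[of "N + k"] Suc q(1) by (intro add_mono mult_left_mono) auto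
      also have "\<dots> = q ^ Suc k * \<bar>y N\<bar> + e / 2"
        by (simp add: d_def field_simps)
      finally show ?case .
    qed
    have "(\<lambda>k. q ^ k * \<bar>y N\<bar>) \<longlonglongrightarrow> 0 * \<bar>y N\<bar>"
      using q by (intro tendsto_mult LIMSEQ_power_zero tendsto_const) auto
    then obtain K where K: "\<And>k. k \<ge> K \<Longrightarrow> \<bar>q ^ k * \<bar>y N\<bar>\<bar> < e / 2"
      using LIMSEQ_D[of _ 0 "e / 2"] e by fastforce
    have "norm (y n - 0) < e" if "n \<ge> N + K" for n
    proof -
      have "N + (n - N) = n" "K \<le> n - N" using that by auto
      then have "\<bar>y n\<bar> \<le> q ^ (n - N) * \<bar>y N\<bar> + e / 2" "\<bar>q ^ (n - N) * \<bar>y N\<bar>\<bar> < e / 2"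
        using bound[of "n - N"] K[of "n - N"] by simp_all
      then show ?thesis by (simp only: real_norm_def abs_less_iff) linarith
    qed
    then show "\<exists>no. \<forall>n\<ge>no. norm (y n - 0) < e" by blast
  qed
  then have "(\<lambda>n. y n + l / (1 - q)) \<longlonglongrightarrow> 0 + l / (1 - q)"
    by (intro tendsto_intros)
  then show ?thesis by (simp add: y_def)
qed

text \<open>Makes the \<open>n + 1\<close> paths of the separator negligible.\<close>

lemma linear_over_exponential:
  fixes r :: real
  assumes "1 < r"
  shows "(\<lambda>n. real (n + 1) / r ^ n) \<longlonglongrightarrow> 0"
proof -
  have "(\<lambda>n. real n * (1 / r) ^ n + (1 / r) ^ n) \<longlonglongrightarrow> 0 + 0"
    using assms by (intro tendsto_add powser_times_n_limit_0 LIMSEQ_power_zero) auto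
  moreover have "real n * (1 / r) ^ n + (1 / r) ^ n = real (n + 1) / r ^ n" for n
    by (simp add: power_one_over add_divide_distrib)
  ultimately show ?thesis by simp
qed

text \<open>Rescaling the counts \<open>W n\<close> by \<open>r ^ n * v\<close> turns the adjacency matrix into a stochastic
  kernel. If some state can be reached from everywhere in exactly \<open>N\<close> steps, then \<open>N\<close> steps of this
  kernel contract the oscillation over \<open>S\<close> by a fixed factor.\<close>

locale walk_counts =
  fixes S :: "'a set" and E :: "('a \<times> 'a) set" and v :: "'a \<Rightarrow> real" and r :: real
    and W :: "nat \<Rightarrow> 'a \<Rightarrow> real" and t0 :: 'a and N :: nat
  assumes finS: "finite S" and E_sub: "E \<subseteq> S \<times> S" and t0: "t0 \<in> S"
    and v_pos: "\<And>s. s \<in> S \<Longrightarrow> 0 < v s" and r_pos: "0 < r"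
    and eig: "\<And>s. s \<in> S \<Longrightarrow> (\<Sum>t\<in>E `` {s}. v t) = r * v s"
    and W_0: "\<And>s. s \<in> S \<Longrightarrow> 0 < W 0 s"
    and W_Suc: "\<And>n s. s \<in> S \<Longrightarrow> W (Suc n) s = (\<Sum>t\<in>E `` {s}. W n t)"
    and reach: "\<And>s. s \<in> S \<Longrightarrow> (s, t0) \<in> E ^^ N"
begin

definition kern :: "'a \<Rightarrow> 'a \<Rightarrow> real" where
  "kern s t = v t / (r * v s)"

text \<open>\<open>kern\<close> is positive off the edges too, so the minimum over all pairs is a
  positive lower bound for the transition probabilities.\<close>

definition min_kern :: real where
  "min_kern = Min ((\<lambda>(s, t). kern s t) ` (S \<times> S))"

definition harmonic :: "(nat \<Rightarrow> 'a \<Rightarrow> real) \<Rightarrow> bool" where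
  "harmonic f \<longleftrightarrow> (\<forall>n. \<forall>s\<in>S. f (Suc n) s = (\<Sum>t\<in>E `` {s}. kern s t * f n t))"

lemma Image_sub: "E `` {s} \<subseteq> S"
  using E_sub by auto

lemma fin_Image: "finite (E `` {s})"
  using finS Image_sub by (rule finite_subset[rotated])

lemma kern_pos: "s \<in> S \<Longrightarrow> t \<in> S \<Longrightarrow> 0 < kern s t"
  using v_pos r_pos by (simp add: kern_def)

lemma sum_kern: "s \<in> S \<Longrightarrow> (\<Sum>t\<in>E `` {s}. kern s t) = 1"
  using eig[of s] v_pos[of s] r_pos by (simp add: kern_def flip: sum_divide_distrib)

lemma min_kern: "0 < min_kern" "s \<in> S \<Longrightarrow> t \<in> S \<Longrightarrow> min_kern \<le> kern s t"
proof -
  let ?K = "(\<lambda>(s, t). kern s t) ` (S \<times> S)"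
  have fin: "finite ?K" using finS by simp
  have "min_kern \<in> ?K" unfolding min_kern_def using fin t0 by (intro Min_in) auto
  then show "0 < min_kern" using kern_pos by auto
  show "min_kern \<le> kern s t" if "s \<in> S" "t \<in> S"
    unfolding min_kern_def using fin that by (intro Min_le) auto
qed

lemma harmonic_uminus: "harmonic f \<Longrightarrow> harmonic (\<lambda>n s. - f n s)"
  by (auto simp: harmonic_def sum_negf)

lemma harmonic_le:
  assumes f: "harmonic f" and le: "\<And>s. s \<in> S \<Longrightarrow> f n s \<le> M" and s: "s \<in> S"
  shows "f (n + k) s \<le> M"
  using s
proof (induction k arbitrary: s)
  case (Suc k)
  have "f (n + Suc k) s = (\<Sum>t\<in>E `` {s}. kern s t * f (n + k) t)"
    using f Suc.prems by (simp add: harmonic_def)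
  also have "\<dots> \<le> (\<Sum>t\<in>E `` {s}. kern s t * M)"
    using Image_sub[of s] Suc.IH less_imp_le[OF kern_pos[OF Suc.prems]]
    by (intro sum_mono mult_left_mono) auto
  also have "\<dots> = M" using sum_kern[OF Suc.prems] by (simp flip: sum_distrib_right)
  finally show ?case .
qed (simp add: le)

text \<open>Each average gives weight at least \<open>min_kern\<close> to the next vertex of the
  walk, so the deficit \<open>M - f n t0\<close> survives \<open>k\<close> steps up to the factor
  \<open>min_kern ^ k\<close>.\<close>

lemma harmonic_contract:
  assumes f: "harmonic f" and le: "\<And>s. s \<in> S \<Longrightarrow> f n s \<le> M"
    and s: "s \<in> S" and walk: "(s, t0) \<in> E ^^ k"
  shows "f (n + k) s \<le> M - min_kern ^ k * (M - f n t0)"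
  using s walk
proof (induction k arbitrary: s)
  case (Suc k)
  obtain t where t: "(s, t) \<in> E" "(t, t0) \<in> E ^^ k" using Suc.prems(2) by (meson relpow_Suc_E2)
  then have tS: "t \<in> S" using E_sub by auto
  let ?d = "min_kern ^ k * (M - f n t0)"
  have d: "0 \<le> ?d" using le[OF t0] min_kern(1) by simp
  have "f (n + Suc k) s = (\<Sum>u\<in>E `` {s}. kern s u * f (n + k) u)"
    using f Suc.prems by (simp add: harmonic_def)
  also have "\<dots> = kern s t * f (n + k) t + (\<Sum>u\<in>E `` {s} - {t}. kern s u * f (n + k) u)"
    using t fin_Image by (intro sum.remove) auto
  also have "\<dots> \<le> kern s t * (M - ?d) + (\<Sum>u\<in>E `` {s} - {t}. kern s u * M)"
    using Suc.IH[OF tS t(2)] Image_sub[of s] less_imp_le[OF kern_pos[OF Suc.prems(1)]] harmonic_le[OF f le] tS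
    by (intro add_mono sum_mono mult_left_mono) auto
  also have "\<dots> = (\<Sum>u\<in>E `` {s}. kern s u * M) - kern s t * ?d"
    using t sum.remove[OF fin_Image, of t s "\<lambda>u. kern s u * M"] by (simp add: right_diff_distrib)
  also have "\<dots> = M - kern s t * ?d"
    using sum_kern[OF Suc.prems(1)] by (simp flip: sum_distrib_right)
  also have "\<dots> \<le> M - min_kern * ?d"
    using min_kern(2)[OF Suc.prems(1) tS] d by (intro diff_left_mono mult_right_mono) auto
  finally show ?case by (simp add: mult.assoc)
qed simp

definition upper :: "(nat \<Rightarrow> 'a \<Rightarrow> real) \<Rightarrow> nat \<Rightarrow> real" where
  "upper f n = Max (f n ` S)"

lemma le_upper: "s \<in> S \<Longrightarrow> f n s \<le> upper f n"
  unfolding upper_def using finS by (intro Max_ge) auto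

lemma upper_attained: "\<exists>s\<in>S. upper f n = f n s"
proof -
  have "upper f n \<in> f n ` S" unfolding upper_def using finS t0 by (intro Max_in) auto
  then show ?thesis by auto
qed

lemma upper_antimono:
  assumes "harmonic f"
  shows "upper f (n + k) \<le> upper f n"
proof -
  obtain s where "s \<in> S" "upper f (n + k) = f (n + k) s" using upper_attained by blast
  then show ?thesis using harmonic_le[where f = f and n = n, OF assms le_upper[of _ f n], of s k] by simp
qed

lemma upper_contract:
  assumes "harmonic f"
  shows "upper f (n + N) \<le> upper f n - min_kern ^ N * (upper f n - f n t0)"
proof -
  obtain s where "s \<in> S" "upper f (n + N) = f (n + N) s" using upper_attained by blast
  then show ?thesis
    using harmonic_contract[where f = f and n = n, OF assms le_upper[of _ f n], of s N] reach[of s] by simp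
qed

text \<open>The oscillation \<open>D\<close> decreases to some \<open>d\<close> with
  \<open>d \<le> (1 - min_kern ^ N) * d\<close>, so \<open>d = 0\<close>, and all values are
  squeezed to the limit of the maxima. The initial minimum keeps that limit positive.\<close>

lemma harmonic_converges:
  assumes f: "harmonic f" and pos: "\<And>s. s \<in> S \<Longrightarrow> 0 < f 0 s"
  obtains c where "0 < c" "\<And>s. s \<in> S \<Longrightarrow> (\<lambda>n. f n s) \<longlonglongrightarrow> c"
proof -
  define g where "g n s = - f n s" for n s
  have g: "harmonic g" using harmonic_uminus[OF f] by (simp add: g_def[abs_def])
  have ord: "- upper g n \<le> f n s" "f n s \<le> upper f n" if "s \<in> S" for n s
    using le_upper[OF that, of g n] le_upper[OF that, of f n] by (auto simp: g_def)
  define D where "D n = upper f n + upper g n" for n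
  have Dpos: "0 \<le> D n" for n using ord[OF t0, of n] by (simp add: D_def)
  have Ddec: "D (Suc n) \<le> D n" for n
    using upper_antimono[OF f, of n 1] upper_antimono[OF g, of n 1] by (simp add: D_def)
  \<comment> \<open>The deficits of \<open>f\<close> and \<open>g = - f\<close> at \<open>t0\<close>
    add up to exactly \<open>D n\<close>.\<close>
  have DN: "D (n + N) \<le> (1 - min_kern ^ N) * D n" for n
    using upper_contract[OF f, of n] upper_contract[OF g, of n] by (simp add: D_def g_def algebra_simps)
  obtain d where d: "D \<longlonglongrightarrow> d"
    using decseq_convergent[of D 0, OF decseq_SucI[of D, OF Ddec]] Dpos by blast
  have "d \<le> (1 - min_kern ^ N) * d"
    using LIMSEQ_ignore_initial_segment[OF d, of N] tendsto_mult_left[OF d, of "1 - min_kern ^ N"] DN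
    by (intro LIMSEQ_le) auto
  then have "min_kern ^ N * d \<le> 0" by (simp add: algebra_simps)
  then have "d \<le> 0" using zero_less_power[OF min_kern(1), of N] by (auto simp: mult_le_0_iff)
  moreover have "0 \<le> d" using d Dpos by (intro LIMSEQ_le_const) auto
  ultimately have D0: "D \<longlonglongrightarrow> 0" using d by simp
  have "upper f (Suc n) \<le> upper f n" for n using upper_antimono[OF f, of n 1] by simp
  moreover have lower: "- upper g 0 \<le> upper f n" for n
    using upper_antimono[OF g, of 0 n] ord[OF t0, of n] by simp
  ultimately obtain c where c: "upper f \<longlonglongrightarrow> c"
    using decseq_convergent[of "upper f" "- upper g 0", OF decseq_SucI[of "upper f"]] by blast
  have lim: "(\<lambda>n. f n s) \<longlonglongrightarrow> c" if "s \<in> S" for s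
  proof (rule tendsto_sandwich)
    show "(\<lambda>n. upper f n - D n) \<longlonglongrightarrow> c" using tendsto_diff[OF c D0] by simp
    show "\<forall>\<^sub>F n in sequentially. upper f n - D n \<le> f n s"
      using ord[OF that] by (simp add: D_def)
    show "\<forall>\<^sub>F n in sequentially. f n s \<le> upper f n" using ord[OF that] by simp
  qed (rule c)
  obtain s where "s \<in> S" "upper g 0 = g 0 s" using upper_attained by blast
  then have "0 < - upper g 0" using pos by (simp add: g_def)
  also have "- upper g 0 \<le> c" using c lower by (intro LIMSEQ_le_const) auto
  finally show ?thesis using that lim by blast
qed

lemma walk_asymptotics:
  obtains c where "0 < c" "\<And>s. s \<in> S \<Longrightarrow> (\<lambda>n. W n s / r ^ n) \<longlonglongrightarrow> c * v s"
proof -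
  define f where "f n s = W n s / (r ^ n * v s)" for n s
  have "harmonic f" unfolding harmonic_def
  proof (intro allI ballI)
    fix n s assume s: "s \<in> S"
    have "kern s t * f n t = W n t / (r ^ Suc n * v s)" if "t \<in> S" for t
      using v_pos[OF that] v_pos[OF s] r_pos by (simp add: kern_def f_def field_simps)
    then have "(\<Sum>t\<in>E `` {s}. kern s t * f n t) = (\<Sum>t\<in>E `` {s}. W n t / (r ^ Suc n * v s))"
      using Image_sub by (intro sum.cong) auto
    also have "\<dots> = f (Suc n) s"
      by (simp add: f_def W_Suc[OF s] flip: sum_divide_distrib)
    finally show "f (Suc n) s = (\<Sum>t\<in>E `` {s}. kern s t * f n t)" ..
  qed
  moreover have "0 < f 0 s" if "s \<in> S" for s using W_0 v_pos that by (simp add: f_def)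
  ultimately obtain c where c: "0 < c" "\<And>s. s \<in> S \<Longrightarrow> (\<lambda>n. f n s) \<longlonglongrightarrow> c"
    using harmonic_converges[of f] by blast
  have "(\<lambda>n. W n s / r ^ n) \<longlonglongrightarrow> c * v s" if "s \<in> S" for s
    using tendsto_mult_right[OF c(2)[OF that], of "v s"] v_pos[OF that] by (simp add: f_def)
  then show ?thesis using that c(1) by blast
qed

end

section \<open>Counting monotone paths\<close>

definition vert :: "step list \<Rightarrow> step list" where
  "vert p = filter (\<lambda>a. a \<noteq> East) p"

definition step_to :: "nat \<times> nat \<Rightarrow> step" where
  "step_to t = (if snd t = fst t then East else if fst t < snd t then North else South)"

text \<open>The state \<open>(i, j)\<close> of a path records that its last step led from height \<open>i\<close> to height \<open>j\<close>.\<close>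

fun admissible :: "nat \<Rightarrow> nat \<times> nat \<Rightarrow> step list \<Rightarrow> bool" where
  "admissible m s [] \<longleftrightarrow> True"
| "admissible m s (a # p) \<longleftrightarrow> (\<exists>t\<in>transfer_edges m `` {s}. step_to t = a \<and> admissible m t p)"

text \<open>The predicate on the vertical word lets one first-step recursion count all classes of
  paths: after a step, \<open>Q\<close> is tested on the word with that letter prepended.\<close>

definition conts :: "nat \<Rightarrow> nat \<Rightarrow> nat \<times> nat \<Rightarrow> (step list \<Rightarrow> bool) \<Rightarrow> step list set" where
  "conts m n s Q = {p. length p = n \<and> admissible m s p \<and> Q (vert p)}"

lemma inj_on_step_to: "inj_on step_to (transfer_edges m `` {(i, j)})"
  by (auto simp: inj_on_def transfer_edges_def transfer_verts_def step_to_def split: if_splits)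

lemma finite_conts: "finite (conts m n s Q)"
proof -
  have "(UNIV :: step set) = {North, South, East}"
    using step.exhaust by auto
  then have "finite (UNIV :: step set)" by (metis finite.emptyI finite_insert)
  then have "finite {p :: step list. set p \<subseteq> UNIV \<and> length p = n}"
    by (rule finite_lists_length_eq)
  then show ?thesis by (rule finite_subset[rotated]) (auto simp: conts_def)
qed

lemma card_conts_Suc:
  "card (conts m (Suc n) s Q) =
     (\<Sum>t\<in>transfer_edges m `` {s}. card (conts m n t (\<lambda>w. Q (vert [step_to t] @ w))))"
proof -
  obtain i j where s: "s = (i, j)" by force
  let ?E = "transfer_edges m `` {s}"
  let ?A = "\<lambda>t. (#) (step_to t) ` conts m n t (\<lambda>w. Q (vert [step_to t] @ w))"
  have "conts m (Suc n) s Q = (\<Union>t\<in>?E. ?A t)"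
  proof (rule Set.set_eqI)
    fix p
    show "p \<in> conts m (Suc n) s Q \<longleftrightarrow> p \<in> (\<Union>t\<in>?E. ?A t)"
    proof (cases p)
      case (Cons a q)
      have v: "vert (a # q) = vert [a] @ vert q" by (simp add: vert_def)
      have "p \<in> conts m (Suc n) s Q \<longleftrightarrow>
        (\<exists>t\<in>?E. a = step_to t \<and> length q = n \<and> admissible m t q \<and> Q (vert [step_to t] @ vert q))"
        unfolding conts_def Cons mem_Collect_eq v by auto
      also have "\<dots> \<longleftrightarrow> p \<in> (\<Union>t\<in>?E. ?A t)"
        unfolding conts_def Cons by blast
      finally show ?thesis .
    qed (auto simp: conts_def)
  qed
  also have "card \<dots> = (\<Sum>t\<in>?E. card (?A t))"
    using inj_on_step_to[of m i j] finite_conts finite_transfer_edges_Image s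
    by (intro card_UN_disjoint) (auto simp: inj_on_def)
  also have "\<dots> = (\<Sum>t\<in>?E. card (conts m n t (\<lambda>w. Q (vert [step_to t] @ w))))"
    by (intro sum.cong refl card_image) (auto simp: inj_on_def)
  finally show ?thesis .
qed

lemma card_conts_step:
  assumes "(i, j) \<in> transfer_verts m"
  shows "card (conts m (Suc n) (i, j) Q) = card (conts m n (j, j) Q)
    + (if j < m \<and> i \<noteq> Suc j then card (conts m n (j, Suc j) (\<lambda>w. Q (North # w))) else 0)
    + (if 0 < j \<and> Suc i \<noteq> j then card (conts m n (j, j - 1) (\<lambda>w. Q (South # w))) else 0)"
  unfolding card_conts_Suc sum_transfer_edges_Image[OF assms]
  by (cases j) (simp_all add: step_to_def vert_def)

lemma conts_False [simp]: "conts m n s (\<lambda>w. False) = {}"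
  by (simp add: conts_def)

lemma card_conts_vert_Nil:
  "s \<in> transfer_verts m \<Longrightarrow> card (conts m n s (\<lambda>w. w = [])) = 1"
proof (induction n arbitrary: s)
  case 0
  have "conts m 0 s (\<lambda>w. w = []) = {[]}" by (auto simp: conts_def vert_def)
  then show ?case by simp
next
  case (Suc n)
  obtain i j where s: "s = (i, j)" by force
  have "(j, j) \<in> transfer_verts m" using Suc.prems by (auto simp: s transfer_verts_def)
  then show ?case using Suc card_conts_step[of i j m n] by (simp add: s)
qed

section \<open>Monotone paths as walks in the transfer graph\<close>

lemma retraces_Cons_Cons:
  "retraces (b # a # p) \<longleftrightarrow> (b, a) \<in> {(North, South), (South, North)} \<or> retraces (a # p)"
proof -
  have *: "(\<exists>i. P i) \<longleftrightarrow> P 0 \<or> (\<exists>i. P (Suc i))" for P :: "nat \<Rightarrow> bool"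
    by (metis not0_implies_Suc)
  show ?thesis unfolding retraces_def by (subst *) simp
qed

lemma retraces_short: "\<not> retraces []" "\<not> retraces [a]"
  by (simp_all add: retraces_def)

lemma retraces_East_Cons: "retraces (East # p) \<longleftrightarrow> retraces p"
  by (cases p) (simp_all add: retraces_short retraces_Cons_Cons)

lemma point_after_simps: "point_after p 0 = 0" "point_after (a # p) (Suc k) = disp a + point_after p k"
  by (simp_all add: point_after_def)

lemma fst_point_after_nonneg: "0 \<le> fst (point_after p k)"
proof (induction p arbitrary: k)
  case (Cons a p)
  then show ?case by (cases k; cases a) (auto simp: point_after_simps)
qed (simp add: point_after_def)

lemma transfer_edges_step:
  assumes "(i, j) \<in> transfer_verts m"
  shows "((i, j), t) \<in> transfer_edges m \<and> step_to t = a \<longleftrightarrow>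
    t = (j, nat (int j + snd (disp a))) \<and> (step_to (i, j), a) \<notin> {(North, South), (South, North)} \<and>
    0 \<le> int j + snd (disp a) \<and> int j + snd (disp a) \<le> int m"
  using assms
  by (cases a; cases t) (auto simp: transfer_edges_def transfer_verts_def step_to_def split: if_splits)

text \<open>Prepending the step recorded by the state makes \<open>retraces\<close> also check the
  junction with the past.\<close>

lemma admissible_iff:
  assumes "(i, j) \<in> transfer_verts m"
  shows "admissible m (i, j) p \<longleftrightarrow> \<not> retraces (step_to (i, j) # p) \<and>
    (\<forall>k\<le>length p. 0 \<le> int j + snd (point_after p k) \<and> int j + snd (point_after p k) \<le> int m)"
  using assms
proof (induction p arbitrary: i j)
  case Nil
  then show ?case by (auto simp: retraces_short point_after_simps transfer_verts_def)
next
  case (Cons a p)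
  define k where "k = nat (int j + snd (disp a))"
  let ?ok = "(step_to (i, j), a) \<notin> {(North, South), (South, North)} \<and>
    0 \<le> int j + snd (disp a) \<and> int j + snd (disp a) \<le> int m"
  let ?h = "\<lambda>j p l. 0 \<le> int j + snd (point_after p l) \<and> int j + snd (point_after p l) \<le> int m"
  have all_le_Suc: "(\<forall>l\<le>Suc n. P l) \<longleftrightarrow> P 0 \<and> (\<forall>l\<le>n. P (Suc l))" for P n
    by (metis Suc_le_mono le0 not0_implies_Suc)
  have j: "j \<le> m" using Cons.prems by (simp add: transfer_verts_def)
  have step: "((i, j), t) \<in> transfer_edges m \<and> step_to t = a \<longleftrightarrow> t = (j, k) \<and> ?ok" for t
    unfolding k_def by (rule transfer_edges_step[OF Cons.prems])
  have "admissible m (i, j) (a # p) \<longleftrightarrow> ?ok \<and> admissible m (j, k) p"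
  proof -
    have "admissible m (i, j) (a # p) \<longleftrightarrow>
      (\<exists>t. (((i, j), t) \<in> transfer_edges m \<and> step_to t = a) \<and> admissible m t p)"
      by (simp only: admissible.simps Bex_def Image_singleton_iff conj_assoc)
    then show ?thesis unfolding step by blast
  qed
  also have "\<dots> \<longleftrightarrow> ?ok \<and> \<not> retraces (a # p) \<and> (\<forall>l\<le>length p. ?h k p l)"
  proof (rule conj_cong[OF refl])
    assume ?ok
    then have e: "((i, j), (j, k)) \<in> transfer_edges m" "step_to (j, k) = a" using step by blast+
    then have "(j, k) \<in> transfer_verts m" by (auto simp: transfer_edges_def)
    from Cons.IH[OF this] show "admissible m (j, k) p \<longleftrightarrow> \<not> retraces (a # p) \<and> (\<forall>l\<le>length p. ?h k p l)"
      by (simp add: e)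
  qed
  also have "\<dots> \<longleftrightarrow> ?ok \<and> \<not> retraces (a # p) \<and> (\<forall>l\<le>length p. ?h j (a # p) (Suc l))"
    by (auto simp: k_def point_after_simps add.assoc)
  also have "\<dots> \<longleftrightarrow> \<not> retraces (step_to (i, j) # a # p) \<and> (\<forall>l\<le>length (a # p). ?h j (a # p) l)"
  proof -
    have "0 \<le> int j + snd (disp a) \<and> int j + snd (disp a) \<le> int m"
      if "\<forall>l\<le>length p. ?h j (a # p) (Suc l)"
      using that[rule_format, of 0] by (simp add: point_after_simps)
    then show ?thesis
      unfolding retraces_Cons_Cons list.size add_Suc_right add_0_right all_le_Suc
      using j by (auto simp: point_after_simps(1))
  qed
  finally show ?case .
qed

text \<open>The initial state \<open>(0, 0)\<close> acts as a fictitious preceding East step, which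
  nothing can retrace; the first coordinate never becomes negative.\<close>

lemma monotone_path_iff_admissible:
  "monotone_path m n p \<longleftrightarrow> length p = n \<and> admissible m (0, 0) p"
proof -
  have strip: "z \<in> strip m \<longleftrightarrow> 0 \<le> fst z \<and> 0 \<le> snd z \<and> snd z \<le> int m" for z
    by (cases z) (simp add: strip_def)
  have "admissible m (0, 0) p \<longleftrightarrow> \<not> retraces (step_to (0, 0) # p) \<and>
    (\<forall>k\<le>length p. 0 \<le> int 0 + snd (point_after p k) \<and> int 0 + snd (point_after p k) \<le> int m)"
    by (rule admissible_iff) (simp add: transfer_verts_def)
  then show ?thesis
    using fst_point_after_nonneg[of p]
    by (auto simp: monotone_path_def strip step_to_def retraces_East_Cons)
qed

lemma kernel_verts_eq: "kernel_verts m n = conts m n (0, 0) (\<lambda>w. True)"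
  by (auto simp: kernel_verts_def conts_def monotone_path_iff_admissible)

text \<open>One East step, \<open>j\<close> South steps and another East step lead to
  \<open>(0, 0)\<close>; its loop pads all these walks to the common length
  \<open>m + 2\<close>.\<close>

lemma reach_origin:
  assumes "s \<in> transfer_verts m"
  shows "(s, (0, 0)) \<in> transfer_edges m ^^ (m + 2)"
proof -
  let ?E = "transfer_edges m"
  have loop: "((0, 0), (0, 0)) \<in> ?E ^^ k" for k
    by (induction k) (auto simp: transfer_edges_def transfer_verts_def intro: relpow_Suc_I)
  have down: "((Suc j, j), (0, 0)) \<in> ?E ^^ Suc j" if "Suc j \<le> m" for j
    using that
  proof (induction j)
    case 0
    have "((Suc 0, 0), (0, 0)) \<in> ?E" using 0 by (auto simp: transfer_edges_def transfer_verts_def)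
    then show ?case by simp
  next
    case (Suc j)
    have e: "((Suc (Suc j), Suc j), (Suc j, j)) \<in> ?E"
      using Suc.prems by (auto simp: transfer_edges_def transfer_verts_def)
    show ?case by (rule relpow_Suc_I2[OF e Suc.IH]) (use Suc.prems in simp)
  qed
  have level: "((j, j), (0, 0)) \<in> ?E ^^ Suc j" if "j \<le> m" for j
  proof (cases j)
    case 0
    then show ?thesis using loop[of 1] by simp
  next
    case (Suc k)
    have e: "((Suc k, Suc k), (Suc k, k)) \<in> ?E"
      using Suc that by (auto simp: transfer_edges_def transfer_verts_def)
    show ?thesis unfolding Suc by (rule relpow_Suc_I2[OF e down]) (use Suc that in simp)
  qed
  obtain i j where s: "s = (i, j)" by force
  have j: "j \<le> m" "((i, j), (j, j)) \<in> ?E"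
    using assms by (auto simp: s transfer_edges_def transfer_verts_def)
  have "(s, (0, 0)) \<in> ?E ^^ Suc (Suc j)" unfolding s
    using j(2) level[OF j(1)] by (rule relpow_Suc_I2)
  then have "(s, (0, 0)) \<in> ?E ^^ (Suc (Suc j) + (m - j))"
    using loop[of "m - j"] unfolding relpow_add by blast
  then show ?thesis using j(1) by simp
qed

lemma conts_asymptotics:
  assumes m: "1 \<le> m"
  obtains c where "0 < c" "\<And>s. s \<in> transfer_verts m \<Longrightarrow>
    (\<lambda>n. real (card (conts m n s (\<lambda>w. True))) / perron_root m ^ n) \<longlonglongrightarrow> c * eigvec (perron_root m) s"
proof -
  let ?r = "perron_root m"
  have root: "is_root m ?r" using m by (rule is_root_perron_root)
  interpret walk_counts "transfer_verts m" "transfer_edges m" "eigvec ?r" ?r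
    "\<lambda>n s. real (card (conts m n s (\<lambda>w. True)))" "(0, 0)" "m + 2"
  proof
    show "finite (transfer_verts m)" by (rule finite_transfer_verts)
    show "transfer_edges m \<subseteq> transfer_verts m \<times> transfer_verts m" by (auto simp: transfer_edges_def)
    show "(0, 0) \<in> transfer_verts m" by (simp add: transfer_verts_def)
    show "0 < ?r" using root_gt_1[OF root] by simp
    fix s assume s: "s \<in> transfer_verts m"
    show "0 < eigvec ?r s" by (rule eigvec_pos[OF root s])
    show "(\<Sum>t\<in>transfer_edges m `` {s}. eigvec ?r t) = ?r * eigvec ?r s" by (rule eigvec_sum[OF root s])
    have "conts m 0 s (\<lambda>w. True) = {[]}" by (auto simp: conts_def)
    then show "0 < real (card (conts m 0 s (\<lambda>w. True)))" by simp
    show "real (card (conts m (Suc n) s (\<lambda>w. True))) =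
      (\<Sum>t\<in>transfer_edges m `` {s}. real (card (conts m n t (\<lambda>w. True))))" for n
      by (simp add: card_conts_Suc)
    show "(s, (0, 0)) \<in> transfer_edges m ^^ (m + 2)" by (rule reach_origin[OF s])
  qed
  show ?thesis using that by (rule walk_asymptotics)
qed

section \<open>The bottleneck\<close>

text \<open>Two distinct vertical steps in a row would retrace, so a switched corner involves East;
  a rotation by 90 degrees exchanges East and a vertical step.\<close>

lemma local_move_vert:
  assumes "local_move p q" "\<not> retraces p"
  shows "vert p = vert q \<or> (\<exists>a. vert p = vert q @ [a] \<or> vert q = vert p @ [a])"
  using assms
proof (induction rule: local_move.induct)
  case (switch_corner a b u v)
  have "(a, b) \<notin> {(North, South), (South, North)}"
  proof
    assume "(a, b) \<in> {(North, South), (South, North)}"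
    then have "retraces (u @ [a, b] @ v)"
      unfolding retraces_def by (intro exI[of _ "length u"]) (auto simp: nth_append)
    then show False using switch_corner by simp
  qed
  then show ?case using switch_corner by (cases a; cases b) (auto simp: vert_def)
next
  case (flip_end b a u)
  then show ?case by (cases a; cases b) (auto simp: vert_def)
qed

definition sep_T :: "nat \<Rightarrow> nat \<Rightarrow> step list set" where
  "sep_T m n = conts m n (0, 0) (\<lambda>w. length w \<le> 1)"

definition sep_B :: "nat \<Rightarrow> nat \<Rightarrow> step list set" where
  "sep_B m n = conts m n (0, 0) (\<lambda>w. take 2 w = [North, South])"

definition sep_A :: "nat \<Rightarrow> nat \<Rightarrow> step list set" where
  "sep_A m n = kernel_verts m n - sep_T m n - sep_B m n"

lemma sep_TB_disjoint: "sep_T m n \<inter> sep_B m n = {}"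
proof -
  have "\<not> (length w \<le> 1 \<and> take 2 w = [North, South])" for w :: "step list"
    by (auto dest: arg_cong[of _ _ length])
  then show ?thesis by (auto simp: sep_T_def sep_B_def conts_def)
qed

lemma sep_subset: "sep_T m n \<subseteq> kernel_verts m n" "sep_B m n \<subseteq> kernel_verts m n"
  by (auto simp: sep_T_def sep_B_def kernel_verts_eq conts_def)

text \<open>Both vertical words have at least two letters and differ at most by an appended letter,
  so they would share their first two.\<close>

lemma no_edge_AB:
  assumes p: "p \<in> sep_A m n" and q: "q \<in> sep_B m n"
  shows "{p, q} \<notin> kernel_edges m n"
proof
  assume "{p, q} \<in> kernel_edges m n"
  then have "local_move p q \<or> local_move q p"
    by (auto simp: kernel_edges_def doubleton_eq_iff)
  moreover have "\<not> retraces p" "\<not> retraces q"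
    using p q sep_subset(2)[of m n] by (auto simp: sep_A_def kernel_verts_def monotone_path_def)
  ultimately have "vert p = vert q \<or> (\<exists>a. vert p = vert q @ [a] \<or> vert q = vert p @ [a])"
    using local_move_vert[of p q] local_move_vert[of q p] by auto
  moreover have vp: "2 \<le> length (vert p)" "take 2 (vert p) \<noteq> [North, South]"
    using p by (auto simp: sep_A_def sep_T_def sep_B_def kernel_verts_eq conts_def)
  moreover have vq: "take 2 (vert q) = [North, South]"
    using q by (auto simp: sep_B_def conts_def)
  moreover have "2 \<le> length (vert q)"
    using arg_cong[OF vq, of length] by simp
  ultimately show False by auto
qed

text \<open>A first East step leaves the same problem for \<open>n\<close>; a first North step
  leaves only the all-East continuation.\<close>

lemma card_sep_T:
  assumes "1 \<le> m"
  shows "card (sep_T m n) = n + 1"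
proof (induction n)
  case 0
  have "sep_T m 0 = {[]}" by (auto simp: sep_T_def conts_def vert_def)
  then show ?case by simp
next
  case (Suc n)
  have "card (conts m n (0, 1) (\<lambda>w. w = [])) = 1"
    using assms by (intro card_conts_vert_Nil) (simp add: transfer_verts_def)
  then show ?case
    using Suc card_conts_step[of 0 0 m n "\<lambda>w. length w \<le> 1"] assms
    by (simp add: sep_T_def transfer_verts_def)
qed

text \<open>In \<open>E\<^sup>a N E\<^sup>b S\<close>, each of the two free blocks of \<open>E\<close> gives an affine recurrence in the length.\<close>

lemma card_sep_B_asymptotics:
  assumes m: "2 \<le> m" and c: "\<And>s. s \<in> transfer_verts m \<Longrightarrow>
    (\<lambda>n. real (card (conts m n s (\<lambda>w. True))) / perron_root m ^ n) \<longlonglongrightarrow> c * eigvec (perron_root m) s"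
  shows "(\<lambda>n. real (card (sep_B m n)) / perron_root m ^ n) \<longlonglongrightarrow>
    C m * (c * eigvec (perron_root m) (0, 0))"
proof -
  define r where "r = perron_root m"
  have root: "is_root m r" unfolding r_def using m by (intro is_root_perron_root) simp
  have r: "1 < r" by (rule root_gt_1[OF root])
  define cnt where "cnt s Q n = real (card (conts m n s Q)) / r ^ n" for s Q n
  let ?Q1 = "\<lambda>w. take 1 w = [South]" and ?Q2 = "\<lambda>w. take 2 w = [North, South]"
  have V: "cnt (1, 0) (\<lambda>w. True) \<longlonglongrightarrow> c * eigvec r (1, 0)"
    using c[of "(1, 0)"] m unfolding cnt_def r_def by (simp add: transfer_verts_def del: eigvec.simps)
  \<comment> \<open>Inside \<open>E^b\<close>: one more East, or the step South, after which the
    path is arbitrary.\<close>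
  have Z: "cnt (1, 1) ?Q1 (Suc n) = 1 / r * cnt (1, 1) ?Q1 n + cnt (1, 0) (\<lambda>w. True) n / r" for n
    using card_conts_step[of 1 1 m n ?Q1] m
    by (simp add: transfer_verts_def cnt_def add_divide_distrib mult.commute)
  have Zlim: "cnt (1, 1) ?Q1 \<longlonglongrightarrow> c * eigvec r (1, 0) / r / (1 - 1 / r)"
    using r by (intro affine_recurrence_limit[of "cnt (1, 1) ?Q1" "1 / r", OF Z] tendsto_intros V) auto
  \<comment> \<open>Right after North, South would retrace and North violates the predicate, so East
    is forced; hence \<open>b \<ge> 1\<close>.\<close>
  have Y: "cnt (0, 1) ?Q1 (Suc n) = cnt (1, 1) ?Q1 n / r" for n
    using card_conts_step[of 0 1 m n ?Q1] m
    by (simp add: transfer_verts_def cnt_def mult.commute)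
  have "(\<lambda>n. cnt (0, 1) ?Q1 (Suc n)) \<longlonglongrightarrow> c * eigvec r (1, 0) / r / (1 - 1 / r) / r"
    unfolding Y using r by (intro tendsto_divide Zlim) auto
  then have Ylim: "cnt (0, 1) ?Q1 \<longlonglongrightarrow> c * eigvec r (1, 0) / r / (1 - 1 / r) / r"
    by (rule LIMSEQ_imp_Suc)
  have X: "cnt (0, 0) ?Q2 (Suc n) = 1 / r * cnt (0, 0) ?Q2 n + cnt (0, 1) ?Q1 n / r" for n
    using card_conts_step[of 0 0 m n ?Q2] m
    by (simp add: transfer_verts_def cnt_def add_divide_distrib mult.commute)
  have "cnt (0, 0) ?Q2 \<longlonglongrightarrow> c * eigvec r (1, 0) / r / (1 - 1 / r) / r / r / (1 - 1 / r)"
    using r by (intro affine_recurrence_limit[of "cnt (0, 0) ?Q2" "1 / r", OF X] tendsto_intros Ylim) auto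
  \<comment> \<open>The two geometric series contribute \<open>r^2 / (r - 1)^2\<close>, the steps N,
    S and the forced E contribute \<open>1 / r^3\<close>, and \<open>eigvec_ratio\<close> supplies
    the last \<open>1 / r\<close>.\<close>
  moreover have "c * eigvec r (1, 0) / r / (1 - 1 / r) / r / r / (1 - 1 / r) = C m * (c * eigvec r (0, 0))"
  proof -
    have "1 - 1 / r = (r - 1) / r" using r by (simp add: field_simps)
    then show ?thesis
      unfolding eigvec_ratio[OF root m] C_def r_def[symmetric]
      using r by (simp add: power2_eq_square del: eigvec.simps)
  qed
  ultimately have "cnt (0, 0) ?Q2 \<longlonglongrightarrow> C m * (c * eigvec r (0, 0))" by (simp only:)
  then show ?thesis unfolding cnt_def[abs_def] sep_B_def r_def .
qed

lemma asymp_equiv_of_scaled_limits: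
  fixes f g h :: "nat \<Rightarrow> real"
  assumes f: "(\<lambda>n. f n / h n) \<longlonglongrightarrow> a * l" and g: "(\<lambda>n. g n / h n) \<longlonglongrightarrow> l"
    and nz: "a \<noteq> 0" "l \<noteq> 0" "\<And>n. h n \<noteq> 0"
  shows "f \<sim>[at_top] (\<lambda>n. a * g n)"
proof (rule asymp_equivI'_const[OF _ nz(1)])
  have "(\<lambda>n. (f n / h n) / (g n / h n)) \<longlonglongrightarrow> a * l / l"
    by (rule tendsto_divide[OF f g nz(2)])
  then show "(\<lambda>n. f n / g n) \<longlonglongrightarrow> a" using nz by simp
qed

lemma C_le_C_2: "2 \<le> m \<Longrightarrow> C m \<le> C 2"
proof (induction m rule: dec_induct)
  case (step m)
  then show ?case using C_strict_anti[of m] by simp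
qed simp

theorem theorem1p2:
  shows "(\<forall>m::nat. m \<ge> 2 \<longrightarrow>
      (\<exists>T A B :: nat \<Rightarrow> step list set.
         (\<forall>n. T n \<subseteq> kernel_verts m n \<and> card (T n) = n + 1 \<and>
              A n \<union> B n = kernel_verts m n - T n \<and> A n \<inter> B n = {} \<and>
              (\<forall>p\<in>A n. \<forall>q\<in>B n. {p, q} \<notin> kernel_edges m n)) \<and>
         (\<lambda>n. real (card (A n))) \<sim>[at_top] (\<lambda>n. (1 - C m) * real (card (kernel_verts m n))) \<and>
         (\<lambda>n. real (card (B n))) \<sim>[at_top] (\<lambda>n. C m * real (card (kernel_verts m n)))))
    \<and> (0.345 \<le> C 2 \<and> C 2 < 0.346)
    \<and> C 2 > C 3 \<and> C 3 > C 4 \<and> (\<forall>m::nat. m \<ge> 4 \<longrightarrow> C m \<ge> C (m + 1))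
    \<and> C \<longlonglongrightarrow> 1.5 - sqrt 2
    \<and> \<bar>(1.5 - sqrt 2) - 0.0858\<bar> < (0.00005 :: real)"
proof (intro conjI allI impI)
  fix m :: nat assume m: "2 \<le> m"
  then have m1: "1 \<le> m" by simp
  define r where "r = perron_root m"
  have root: "is_root m r" unfolding r_def by (rule is_root_perron_root[OF m1])
  have r: "1 < r" by (rule root_gt_1[OF root])
  obtain c where c: "0 < c" "\<And>s. s \<in> transfer_verts m \<Longrightarrow>
    (\<lambda>n. real (card (conts m n s (\<lambda>w. True))) / perron_root m ^ n) \<longlonglongrightarrow> c * eigvec (perron_root m) s"
    using conts_asymptotics[OF m1] by blast
  define l where "l = c * eigvec r (0, 0)"
  have V00: "(0, 0) \<in> transfer_verts m" by (simp add: transfer_verts_def)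
  have l: "0 < l" unfolding l_def using c(1) eigvec_pos[OF root V00] by simp
  have P: "(\<lambda>n. real (card (kernel_verts m n)) / r ^ n) \<longlonglongrightarrow> l"
    using c(2)[OF V00] by (simp add: kernel_verts_eq l_def r_def del: eigvec.simps)
  have B: "(\<lambda>n. real (card (sep_B m n)) / r ^ n) \<longlonglongrightarrow> C m * l"
    using card_sep_B_asymptotics[OF m c(2)] by (simp add: l_def r_def del: eigvec.simps)
  have card: "real (card (sep_A m n)) = real (card (kernel_verts m n)) - real (n + 1) - real (card (sep_B m n))" for n
  proof -
    have fin: "finite (kernel_verts m n)" by (simp add: kernel_verts_eq finite_conts)
    have "card (kernel_verts m n) = card (sep_A m n) + card (sep_T m n \<union> sep_B m n)"
      using card_Diff_subset[of "sep_T m n \<union> sep_B m n" "kernel_verts m n"] fin sep_subset[of m n]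
        card_mono[of "kernel_verts m n" "sep_T m n \<union> sep_B m n"]
      by (simp add: sep_A_def Diff_Diff_Int Un_Diff Diff_eq Int_assoc finite_subset)
    also have "card (sep_T m n \<union> sep_B m n) = (n + 1) + card (sep_B m n)"
      using card_Un_disjoint[OF _ _ sep_TB_disjoint, of m n] card_sep_T[OF m1]
        finite_subset[OF sep_subset(1) fin] finite_subset[OF sep_subset(2) fin] by simp
    finally show ?thesis by simp
  qed
  have "(\<lambda>n. real (card (kernel_verts m n)) / r ^ n - real (n + 1) / r ^ n - real (card (sep_B m n)) / r ^ n)
      \<longlonglongrightarrow> l - 0 - C m * l"
    by (intro tendsto_diff P B linear_over_exponential r)
  then have A: "(\<lambda>n. real (card (sep_A m n)) / r ^ n) \<longlonglongrightarrow> (1 - C m) * l"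
    unfolding card by (simp add: diff_divide_distrib left_diff_distrib)
  \<comment> \<open>Both \<open>C m\<close> and \<open>1 - C m\<close> must be nonzero for a limit
    of quotients to give asymptotic equivalence.\<close>
  have C: "0 < C m" using r by (simp add: C_def r_def)
  have C1: "C m < 1" using C_le_C_2[OF m] C_2_bounds(2) by simp
  show "\<exists>T A B :: nat \<Rightarrow> step list set.
         (\<forall>n. T n \<subseteq> kernel_verts m n \<and> card (T n) = n + 1 \<and>
              A n \<union> B n = kernel_verts m n - T n \<and> A n \<inter> B n = {} \<and>
              (\<forall>p\<in>A n. \<forall>q\<in>B n. {p, q} \<notin> kernel_edges m n)) \<and>
         (\<lambda>n. real (card (A n))) \<sim>[at_top] (\<lambda>n. (1 - C m) * real (card (kernel_verts m n))) \<and>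
         (\<lambda>n. real (card (B n))) \<sim>[at_top] (\<lambda>n. C m * real (card (kernel_verts m n)))"
  proof (intro exI conjI allI ballI)
    fix n
    show "sep_T m n \<subseteq> kernel_verts m n" by (rule sep_subset)
    show "card (sep_T m n) = n + 1" by (rule card_sep_T[OF m1])
    show "sep_A m n \<union> sep_B m n = kernel_verts m n - sep_T m n"
      using sep_subset[of m n] sep_TB_disjoint[of m n] by (auto simp: sep_A_def)
    show "sep_A m n \<inter> sep_B m n = {}" by (auto simp: sep_A_def)
    show "{p, q} \<notin> kernel_edges m n" if "p \<in> sep_A m n" "q \<in> sep_B m n" for p q
      using that by (rule no_edge_AB)
  next
    show "(\<lambda>n. real (card (sep_A m n))) \<sim>[at_top] (\<lambda>n. (1 - C m) * real (card (kernel_verts m n)))"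
      using C1 l r by (intro asymp_equiv_of_scaled_limits[OF A P]) auto
    show "(\<lambda>n. real (card (sep_B m n))) \<sim>[at_top] (\<lambda>n. C m * real (card (kernel_verts m n)))"
      using C l r by (intro asymp_equiv_of_scaled_limits[OF B P]) auto
  qed
next
  show "0.345 \<le> C 2" "C 2 < 0.346" by (rule C_2_bounds)+
  show "C 3 < C 2" "C 4 < C 3" using C_strict_anti[of 2] C_strict_anti[of 3] by simp_all
  show "C (m + 1) \<le> C m" if "4 \<le> m" for m using C_strict_anti[of m] that by simp
  show "C \<longlonglongrightarrow> 1.5 - sqrt 2" by (rule C_limit)
  have "1.4142 < sqrt 2" "sqrt 2 < 1.41424"
    by (intro real_less_rsqrt real_less_lsqrt; simp add: power2_eq_square)+
  then show "\<bar>(1.5 - sqrt 2) - 0.0858\<bar> < (0.00005 :: real)" by (simp add: abs_less_iff)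
qed

end
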